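(* Let $Q$ be a configuration manifold, let $L:TQ\to\mathbb{R}$ be a Lagrangian that is Lipschitz continuous in both variables $(q,v)$, let $\Psi_h:TQ\to TQ$ be a $p$-th order accurate one-step method for the Euler--Lagrange equation of $L$, and let $\int_0^h f(x)\,dx\approx h\sum_{i=0}^n b_i f(c_i h)$ be a $q$-th order accurate quadrature formula with nodes $0=c_0<c_1<\dots<c_{n-1}<c_n=1$ and weights $b_i$ (some of which may be zero). Let $L_d$ be the associated shooting-based discrete Lagrangian, $$L_d(q_0,q_1;h)=h\sum_{i=0}^n b_i L(q^i,v^i),\qquad (q^{i+1},v^{i+1})=\Psi_{(c_{i+1}-c_i)h}(q^i,v^i)\ \ (0\le i\le n-1),\quad q^0=q_0,\ q^n=q_1.$$ Then $L_d$ has order of accuracy $\min(p,q)$, i.e. $$L_d(q_0,q_1;h)=L_d^E(q_0,q_1;h)+\mathcal{O}\big(h^{\min(p,q)+1}\big),$$ where $L_d^E(q_0,q_1;h)=\int_0^h L(q_{01}(t),\dot q_{01}(t))\,dt$ is the exact discrete Lagrangian, with $q_{01}$ the solution of the Euler--Lagrange equation of $L$ on $(0,h)$ satisfying $q_{01}(0)=q_0$ and $q_{01}(h)=q_1$.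
   Context: All error estimates are understood in local coordinates on $Q$. Discrete Lagrangian order: a discrete Lagrangian $L_d$ has order of accuracy $r$ if $L_d(q_0,q_1;h)=L_d^E(q_0,q_1;h)+\mathcal{O}(h^{r+1})$. As usual in variational error analysis, the $\mathcal{O}$ is as $h\to0$ along pairs $q_0=q_{01}(0)$, $q_1=q_{01}(h)$ coming from solutions of the Euler--Lagrange equation whose initial conditions $(q_{01}(0),\dot q_{01}(0))$ range over an open subset of $TQ$ with compact closure, with constants uniform over this set. One-step method order: $\Psi_h$ is $p$-th order accurate ($p\ge1$) if its local truncation error is $\mathcal{O}(h^{p+1})$, i.e. $\Psi_h(q,v)$ differs from the exact time-$h$ flow of the Euler--Lagrange equation (written as a first-order system on $TQ$) by $\mathcal{O}(h^{p+1})$, uniformly on compact subsets of $TQ$. Quadrature order: the formula is $q$-th order accurate if $\int_0^h f(x)\,dx=h\sum_{i=0}^n b_i f(c_ih)+\mathcal{O}(h^{q+1})$ for all sufficiently smooth $f$. (The integer $q$ here is not to be confused with the configuration variable.) Standing assumptions: the Euler--Lagrange equation is a second-order (in general nonlinear) ordinary differential equation; the solution $q_{01}$ of the two-point boundary-value problem is isolated and sufficiently regular (in particular, $t\mapsto L(q_{01}(t),\dot q_{01}(t))$ is smooth enough for the quadrature formula to attain its order); and the shooting solution $(q^i,v^i)_{i=0}^n$ is fully converged, i.e. it satisfies the boundary condition $q^n=q_1$ exactly and is the shooting solution corresponding to the isolated solution $q_{01}$ (its initial data $(q^0,v^0)$ remain, as $h\to0$, in a fixed compact subset of $TQ$). 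*)

theory Defs
  imports "HOL-Analysis.Analysis" "HOL-Library.Landau_Symbols"
begin

section \<open>Smoothness and local Lipschitz continuity\<close>

text \<open>For open \<open>S\<close>: \<open>f\<close> is of class \<open>C^k\<close> on \<open>S\<close>.\<close>

primrec C_k_on :: "nat \<Rightarrow> 'a::real_normed_vector set \<Rightarrow> ('a \<Rightarrow> 'b::real_normed_vector) \<Rightarrow> bool" where
  "C_k_on 0 S f \<longleftrightarrow> continuous_on S f"
| "C_k_on (Suc k) S f \<longleftrightarrow>
     (\<forall>x\<in>S. f differentiable (at x)) \<and> (\<forall>v. C_k_on k S (\<lambda>x. frechet_derivative f (at x) v))"

text \<open>On an open subset of a Euclidean space this is the same as local Lipschitz continuity.\<close>

definition lipschitz_on_compacts :: "'a::metric_space set \<Rightarrow> ('a \<Rightarrow> 'b::metric_space) \<Rightarrow> bool" where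
  "lipschitz_on_compacts S f \<longleftrightarrow> (\<forall>C\<subseteq>S. compact C \<longrightarrow> (\<exists>M. M-lipschitz_on C f))"

text \<open>\<open>f\<close> is \<open>C^k\<close> on the interval \<open>J\<close> (with one-sided derivatives at its end points), and it and
  its first \<open>k\<close> derivatives are bounded by \<open>B\<close>; \<open>g m\<close> is the \<open>m\<close>-th derivative.\<close>

definition C_k_bounded_by :: "nat \<Rightarrow> real \<Rightarrow> real set \<Rightarrow> (real \<Rightarrow> real) \<Rightarrow> bool" where
  "C_k_bounded_by k B J f \<longleftrightarrow>
     (\<exists>g :: nat \<Rightarrow> real \<Rightarrow> real.
        (\<forall>t\<in>J. g 0 t = f t) \<and>
        (\<forall>m<k. \<forall>t\<in>J. (g m has_real_derivative g (Suc m) t) (at t within J)) \<and>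
        (\<forall>m\<le>k. continuous_on J (g m) \<and> (\<forall>t\<in>J. \<bar>g m t\<bar> \<le> B)))"


section \<open>Smooth manifolds and their tangent bundles\<close>

text \<open>The manifold is the whole (Hausdorff, second countable) type \<open>'m\<close>, modelled on the Euclidean
  space \<open>'a\<close>. An atlas is a family of charts (domain and coordinate map) indexed by an arbitrary
  type \<open>'i\<close>; charts with empty domain are allowed, so every set of charts is such a family.\<close>

type_synonym ('i, 'm, 'a) atlas = "'i \<Rightarrow> 'm set \<times> ('m \<Rightarrow> 'a)"

definition cdom :: "('i, 'm, 'a) atlas \<Rightarrow> 'i \<Rightarrow> 'm set" where
  "cdom A i = fst (A i)"

definition cmap :: "('i, 'm, 'a) atlas \<Rightarrow> 'i \<Rightarrow> 'm \<Rightarrow> 'a" where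
  "cmap A i = snd (A i)"

definition cinv :: "('i, 'm, 'a) atlas \<Rightarrow> 'i \<Rightarrow> 'a \<Rightarrow> 'm" where
  "cinv A i = inv_into (cdom A i) (cmap A i)"

definition smooth_atlas ::
    "('i, 'm::{t2_space,second_countable_topology}, 'a::euclidean_space) atlas \<Rightarrow> bool" where
  "smooth_atlas A \<longleftrightarrow>
     (\<Union>i. cdom A i) = UNIV \<and>
     (\<forall>i. open (cdom A i) \<and> open (cmap A i ` cdom A i) \<and>
          homeomorphism (cdom A i) (cmap A i ` cdom A i) (cmap A i) (cinv A i)) \<and>
     (\<forall>i j k. C_k_on k (cmap A i ` (cdom A i \<inter> cdom A j)) (cmap A j \<circ> cinv A i))"

text \<open>A tangent vector at \<open>x\<close> is given by its components \<open>v i\<close> in all charts around \<open>x\<close>, which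
  transform by the derivatives of the chart transitions; \<open>v i = 0\<close> for the charts not containing \<open>x\<close>
  is only a normalization.\<close>

definition tangent_bundle ::
    "('i, 'm, 'a::euclidean_space) atlas \<Rightarrow> ('m \<times> ('i \<Rightarrow> 'a)) set" where
  "tangent_bundle A = {(x, v).
     (\<forall>i. x \<notin> cdom A i \<longrightarrow> v i = 0) \<and>
     (\<forall>i j. x \<in> cdom A i \<inter> cdom A j \<longrightarrow>
        v j = frechet_derivative (cmap A j \<circ> cinv A i) (at (cmap A i x)) (v i))}"

definition tdom :: "('i, 'm, 'a::euclidean_space) atlas \<Rightarrow> 'i \<Rightarrow> ('m \<times> ('i \<Rightarrow> 'a)) set" where
  "tdom A i = {z \<in> tangent_bundle A. fst z \<in> cdom A i}"

definition tmap :: "('i, 'm, 'a) atlas \<Rightarrow> 'i \<Rightarrow> 'm \<times> ('i \<Rightarrow> 'a) \<Rightarrow> 'a \<times> 'a" where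
  "tmap A i z = (cmap A i (fst z), snd z i)"

text \<open>The image of \<open>tdom A i\<close> under \<open>tmap A i\<close>:\<close>

definition tcoords :: "('i, 'm, 'a) atlas \<Rightarrow> 'i \<Rightarrow> ('a \<times> 'a) set" where
  "tcoords A i = (cmap A i ` cdom A i) \<times> UNIV"

definition tangent_topology ::
    "('i, 'm, 'a::euclidean_space) atlas \<Rightarrow> ('m \<times> ('i \<Rightarrow> 'a)) topology" where
  "tangent_topology A =
     topology_generated_by {{z \<in> tdom A i. tmap A i z \<in> V} | i V. open V}"

text \<open>The curve of positions and velocities of \<open>x : [0,T] \<rightarrow> Q\<close> in the tangent bundle.\<close>

definition tangent_lift ::
    "('i, 'm, 'a::euclidean_space) atlas \<Rightarrow> real \<Rightarrow> (real \<Rightarrow> 'm) \<Rightarrow> real \<Rightarrow> 'm \<times> ('i \<Rightarrow> 'a)" where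
  "tangent_lift A T x t =
     (x t, \<lambda>i. if x t \<in> cdom A i
               then vector_derivative (cmap A i \<circ> x) (at t within {0..T}) else 0)"


section \<open>Lagrangians and the Euler--Lagrange equation\<close>

definition local_lagrangian ::
    "('i, 'm, 'a::euclidean_space) atlas \<Rightarrow> ('m \<times> ('i \<Rightarrow> 'a) \<Rightarrow> real) \<Rightarrow> 'i \<Rightarrow> 'a \<times> 'a \<Rightarrow> real" where
  "local_lagrangian A L i u = L (inv_into (tdom A i) (tmap A i) u)"

text \<open>A manifold carries no distinguished metric, so Lipschitz continuity in \<open>(q, v)\<close> is understood in
  local coordinates and on compact sets; a global Lipschitz bound (which already \<open>v\<^sup>2 / 2\<close> violates)
  is not required.\<close>

definition lipschitz_lagrangian ::
    "('i, 'm, 'a::euclidean_space) atlas \<Rightarrow> ('m \<times> ('i \<Rightarrow> 'a) \<Rightarrow> real) \<Rightarrow> bool" where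
  "lipschitz_lagrangian A L \<longleftrightarrow>
     (\<forall>i. lipschitz_on_compacts (tcoords A i) (local_lagrangian A L i))"

text \<open>\<open>y\<close> is continuously differentiable and
  \<open>d/dt (\<partial>l/\<partial>v (y, y') w) = \<partial>l/\<partial>y (y, y') w\<close> for all directions \<open>w\<close>, at all times in \<open>J\<close>.\<close>

definition euler_lagrange :: "('a::euclidean_space \<times> 'a \<Rightarrow> real) \<Rightarrow> real set \<Rightarrow> (real \<Rightarrow> 'a) \<Rightarrow> bool" where
  "euler_lagrange l J y \<longleftrightarrow>
     (let y' = (\<lambda>t. vector_derivative y (at t within J));
          dl = (\<lambda>t. frechet_derivative l (at (y t, y' t)))
      in (\<forall>t\<in>J. y differentiable (at t within J)) \<and> continuous_on J y' \<and>
         (\<forall>w. \<forall>t\<in>J. ((\<lambda>s. dl s (0, w)) has_real_derivative dl t (w, 0)) (at t within J)))"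

definition second_order_ode :: "('a::euclidean_space \<times> 'a \<Rightarrow> 'a) \<Rightarrow> real set \<Rightarrow> (real \<Rightarrow> 'a) \<Rightarrow> bool" where
  "second_order_ode F J y \<longleftrightarrow>
     (\<exists>v. \<forall>t\<in>J. (y has_vector_derivative v t) (at t within J) \<and>
               (v has_vector_derivative F (y t, v t)) (at t within J))"

text \<open>The set of times at which \<open>x\<close> is in a given chart is relatively open in \<open>{0..T}\<close>, so the
  derivatives within this set are the derivatives within \<open>{0..T}\<close>.\<close>

definition EL_solution ::
    "('i, 'm::topological_space, 'a::euclidean_space) atlas \<Rightarrow> ('m \<times> ('i \<Rightarrow> 'a) \<Rightarrow> real) \<Rightarrow>
     real \<Rightarrow> (real \<Rightarrow> 'm) \<Rightarrow> bool" where
  "EL_solution A L T x \<longleftrightarrow>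
     continuous_on {0..T} x \<and>
     (\<forall>i. euler_lagrange (local_lagrangian A L i) {t \<in> {0..T}. x t \<in> cdom A i} (cmap A i \<circ> x))"

text \<open>The Euler--Lagrange equation is a (regular, in general nonlinear) second-order ordinary
  differential equation. Local Lipschitz continuity of the right-hand side makes the flow
  well defined.\<close>

definition EL_second_order ::
    "('i, 'm, 'a::euclidean_space) atlas \<Rightarrow> ('m \<times> ('i \<Rightarrow> 'a) \<Rightarrow> real) \<Rightarrow> bool" where
  "EL_second_order A L \<longleftrightarrow>
     (\<forall>i. (\<forall>u\<in>tcoords A i. local_lagrangian A L i differentiable (at u)) \<and>
          (\<exists>F. lipschitz_on_compacts (tcoords A i) F \<and>
               (\<forall>T>0. \<forall>y. y ` {0..T} \<subseteq> cmap A i ` cdom A i \<longrightarrow>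
                  (euler_lagrange (local_lagrangian A L i) {0..T} y \<longleftrightarrow>
                   second_order_ode F {0..T} y))))"

text \<open>The graph of the time-\<open>h\<close> flow on the tangent bundle:\<close>

definition EL_flow ::
    "('i, 'm::topological_space, 'a::euclidean_space) atlas \<Rightarrow> ('m \<times> ('i \<Rightarrow> 'a) \<Rightarrow> real) \<Rightarrow>
     real \<Rightarrow> 'm \<times> ('i \<Rightarrow> 'a) \<Rightarrow> 'm \<times> ('i \<Rightarrow> 'a) \<Rightarrow> bool" where
  "EL_flow A L h z w \<longleftrightarrow>
     (\<exists>x. EL_solution A L h x \<and> tangent_lift A h x 0 = z \<and> tangent_lift A h x h = w)"


section \<open>One-step methods and quadrature formulas\<close>

text \<open>The local truncation error, measured in local coordinates, is \<open>O(h^(p+1))\<close> uniformly on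
  compact subsets of the tangent bundle.\<close>

definition one_step_method_order ::
    "('i, 'm::topological_space, 'a::euclidean_space) atlas \<Rightarrow> ('m \<times> ('i \<Rightarrow> 'a) \<Rightarrow> real) \<Rightarrow>
     (real \<Rightarrow> 'm \<times> ('i \<Rightarrow> 'a) \<Rightarrow> 'm \<times> ('i \<Rightarrow> 'a)) \<Rightarrow> nat \<Rightarrow> bool" where
  "one_step_method_order A L \<Psi> p \<longleftrightarrow>
     (\<forall>i. \<forall>K\<subseteq>tdom A i. compactin (tangent_topology A) K \<longrightarrow>
        (\<exists>C. \<exists>h0>0. \<forall>z\<in>K. \<forall>h. 0 < h \<and> h \<le> h0 \<longrightarrow>
           (\<exists>w. EL_flow A L h z w \<and> w \<in> tdom A i \<and> \<Psi> h z \<in> tdom A i \<and>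
                norm (tmap A i (\<Psi> h z) - tmap A i w) \<le> C * h ^ (p + 1))))"

definition quadrature_order :: "nat \<Rightarrow> (nat \<Rightarrow> real) \<Rightarrow> (nat \<Rightarrow> real) \<Rightarrow> nat \<Rightarrow> bool" where
  "quadrature_order n b c q \<longleftrightarrow>
     (\<exists>m. \<forall>f :: real \<Rightarrow> real. C_k_on m UNIV f \<longrightarrow>
        (\<lambda>h. integral {0..h} f - h * (\<Sum>i\<le>n. b i * f (c i * h))) \<in> O[at_right 0](\<lambda>h. h ^ (q + 1)))"


section \<open>Discrete Lagrangians\<close>

text \<open>\<open>z 0, \<dots>, z n\<close> is a fully converged solution of the shooting problem from \<open>x0\<close> to \<open>x1\<close>.\<close>

definition shooting_solution ::
    "('i, 'm, 'a::euclidean_space) atlas \<Rightarrow> (real \<Rightarrow> 'm \<times> ('i \<Rightarrow> 'a) \<Rightarrow> 'm \<times> ('i \<Rightarrow> 'a)) \<Rightarrow>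
     nat \<Rightarrow> (nat \<Rightarrow> real) \<Rightarrow> 'm \<Rightarrow> 'm \<Rightarrow> real \<Rightarrow> (nat \<Rightarrow> 'm \<times> ('i \<Rightarrow> 'a)) \<Rightarrow> bool" where
  "shooting_solution A \<Psi> n c x0 x1 h z \<longleftrightarrow>
     z 0 \<in> tangent_bundle A \<and>
     (\<forall>i<n. z (Suc i) = \<Psi> ((c (Suc i) - c i) * h) (z i)) \<and>
     fst (z 0) = x0 \<and> fst (z n) = x1"

text \<open>Here \<open>Z x0 x1 h\<close> is the shooting solution selected for the boundary data \<open>x0\<close>, \<open>x1\<close> and the
  step size \<open>h\<close>.\<close>

definition shooting_discrete_lagrangian ::
    "('m \<times> ('i \<Rightarrow> 'a) \<Rightarrow> real) \<Rightarrow> nat \<Rightarrow> (nat \<Rightarrow> real) \<Rightarrow>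
     ('m \<Rightarrow> 'm \<Rightarrow> real \<Rightarrow> nat \<Rightarrow> 'm \<times> ('i \<Rightarrow> 'a)) \<Rightarrow> 'm \<Rightarrow> 'm \<Rightarrow> real \<Rightarrow> real" where
  "shooting_discrete_lagrangian L n b Z x0 x1 h = h * (\<Sum>i\<le>n. b i * L (Z x0 x1 h i))"

text \<open>The exact discrete Lagrangian at \<open>(x 0, x h; h)\<close>, where \<open>x\<close> is the solution of the
  Euler--Lagrange equation joining \<open>x 0\<close> and \<open>x h\<close>.\<close>

definition exact_discrete_lagrangian ::
    "('i, 'm, 'a::euclidean_space) atlas \<Rightarrow> ('m \<times> ('i \<Rightarrow> 'a) \<Rightarrow> real) \<Rightarrow>
     real \<Rightarrow> (real \<Rightarrow> 'm) \<Rightarrow> real" where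
  "exact_discrete_lagrangian A L h x = integral {0..h} (\<lambda>t. L (tangent_lift A h x t))"

text \<open>The boundary data \<open>(x 0, x h)\<close> come from solutions \<open>x\<close> with initial conditions in \<open>U\<close>. If the
  closure of \<open>U\<close> is compact, then for small \<open>h\<close> such a solution is determined by its boundary data.\<close>

definition discrete_lagrangian_order ::
    "('i, 'm::topological_space, 'a::euclidean_space) atlas \<Rightarrow> ('m \<times> ('i \<Rightarrow> 'a) \<Rightarrow> real) \<Rightarrow>
     ('m \<times> ('i \<Rightarrow> 'a)) set \<Rightarrow> ('m \<Rightarrow> 'm \<Rightarrow> real \<Rightarrow> real) \<Rightarrow> nat \<Rightarrow> bool" where
  "discrete_lagrangian_order A L U Ld r \<longleftrightarrow>
     (\<exists>C. \<exists>h0>0. \<forall>h x. 0 < h \<and> h \<le> h0 \<and> EL_solution A L h x \<and> tangent_lift A h x 0 \<in> U \<longrightarrow>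
        \<bar>Ld (x 0) (x h) h - exact_discrete_lagrangian A L h x\<bar> \<le> C * h ^ (r + 1))"

text \<open>Along the solutions starting in \<open>U\<close>, the Lagrangian is a \<open>C^k\<close> function of time, uniformly.\<close>

definition C_k_along_solutions ::
    "('i, 'm::topological_space, 'a::euclidean_space) atlas \<Rightarrow> ('m \<times> ('i \<Rightarrow> 'a) \<Rightarrow> real) \<Rightarrow>
     ('m \<times> ('i \<Rightarrow> 'a)) set \<Rightarrow> nat \<Rightarrow> bool" where
  "C_k_along_solutions A L U k \<longleftrightarrow>
     (\<exists>B. \<exists>h0>0. \<forall>h x. 0 < h \<and> h \<le> h0 \<and> EL_solution A L h x \<and> tangent_lift A h x 0 \<in> U \<longrightarrow>
        C_k_bounded_by k B {0..h} (\<lambda>t. L (tangent_lift A h x t)))"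

text \<open>For small \<open>h\<close> and boundary data coming from solutions starting in \<open>U\<close>, \<open>Z\<close> selects shooting
  solutions whose initial data stay in a compact set. This singles out the shooting solution
  belonging to the given solution of the boundary-value problem: the initial velocities of other
  ones are unbounded as \<open>h \<rightarrow> 0\<close>.\<close>

definition converged_shooting ::
    "('i, 'm::topological_space, 'a::euclidean_space) atlas \<Rightarrow> ('m \<times> ('i \<Rightarrow> 'a) \<Rightarrow> real) \<Rightarrow>
     ('m \<times> ('i \<Rightarrow> 'a)) set \<Rightarrow> (real \<Rightarrow> 'm \<times> ('i \<Rightarrow> 'a) \<Rightarrow> 'm \<times> ('i \<Rightarrow> 'a)) \<Rightarrow> nat \<Rightarrow> (nat \<Rightarrow> real) \<Rightarrow>
     ('m \<Rightarrow> 'm \<Rightarrow> real \<Rightarrow> nat \<Rightarrow> 'm \<times> ('i \<Rightarrow> 'a)) \<Rightarrow> bool" where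
  "converged_shooting A L U \<Psi> n c Z \<longleftrightarrow>
     (\<exists>K. compactin (tangent_topology A) K \<and>
        (\<exists>h0>0. \<forall>h x. 0 < h \<and> h \<le> h0 \<and> EL_solution A L h x \<and> tangent_lift A h x 0 \<in> U \<longrightarrow>
           shooting_solution A \<Psi> n c (x 0) (x h) h (Z (x 0) (x h) h) \<and> Z (x 0) (x h) h 0 \<in> K))"

end

theory Submission
  imports Defs
begin

text \<open>The discrete curve given by the shooting method and the exact solution agree at both end points.
  In a chart, the differences \<open>e i = (a i, w i)\<close> of positions and velocities at the nodes satisfy a
  recurrence with local errors \<open>O(h^(p+1))\<close>, so that \<open>a i = c i * h * w 0 + O(h\<^sup>2 |w 0|) + O(h^(p+1))\<close>.
  Then \<open>a n = 0\<close> gives \<open>w 0 = O(h^p)\<close>, hence \<open>e i = O(h^p)\<close> for all \<open>i\<close>. As the Lagrangian is Lipschitz, the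
  factor \<open>h\<close> of the quadrature sum makes the resulting error \<open>O(h^(p+1))\<close>; the quadrature formula
  applied along the exact solution contributes \<open>O(h^(q+1))\<close>, uniformly, as it is exact on polynomials of
  degree less than \<open>q\<close>. Finitely many charts suffice by compactness.\<close>

section \<open>Quadrature\<close>

text \<open>The two-point problem costs one power of \<open>h\<close>: the end condition controls
  only \<open>h * w 0\<close>, and dividing by \<open>h\<close> turns local errors O(h^(p+1)) into
  velocity errors O(h^p). The division succeeds only because positions are tracked to second order
  in \<open>h\<close>. A plain Gronwall bound would give
  \<open>a n = O(h |w 0|) + O(h^(p+1))\<close>, with no dominant term from which \<open>w 0\<close>
  could be recovered; hence the separate estimates for positions and velocities. Uniformity is the
  other obstacle. The constant in \<open>quadrature_order\<close> depends on the integrand, whereas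
  the integrand here changes with \<open>h\<close> and with the solution; exactness on monomials
  removes this dependence. Errors in coordinates make sense only while both curves are in one chart:
  they start over the same point \<open>x 0\<close>, and bounded speed keeps them in the chart for
  small \<open>h\<close>.\<close>

lemma C_k_on_monomial: "C_k_on m UNIV (\<lambda>x::real. a * x ^ k)"
proof (induction m arbitrary: a k)
  case 0
  then show ?case by (auto intro!: continuous_intros)
next
  case (Suc m)
  have d: "((\<lambda>x::real. a * x ^ k) has_derivative (\<lambda>v. a * (of_nat k * v * x ^ (k - 1)))) (at x)" for x
    by (auto intro!: derivative_eq_intros)
  \<comment> \<open>Differentiation stays within this family because the new factors go into the
    coefficient; hence \<open>a\<close> is generalised in the induction. For \<open>k = 0\<close>
    the truncated exponent \<open>k - 1\<close> is harmless, as the coefficient vanishes.\<close>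
  have "frechet_derivative (\<lambda>x::real. a * x ^ k) (at x) v = (a * of_nat k * v) * x ^ (k - 1)" for x v
    using frechet_derivative_at[OF d[of x]] by (metis mult.assoc)
  with Suc d show ?case
    by (auto simp: differentiable_def)
qed

lemma integral_power_Icc:
  fixes h :: real
  assumes "0 \<le> h"
  shows "((\<lambda>x. x ^ k) has_integral h ^ Suc k / real (Suc k)) {0..h}"
proof -
  have "((\<lambda>x. x ^ k) has_integral (h ^ Suc k / real (Suc k) - 0 ^ Suc k / real (Suc k))) {0..h}"
  proof (rule fundamental_theorem_of_calculus[OF assms])
    fix x :: real
    have "((\<lambda>x. x ^ Suc k / real (Suc k)) has_real_derivative real (Suc k) * x ^ k / real (Suc k))
        (at x within {0..h})"
      using DERIV_pow[of "Suc k"] by (intro DERIV_cdivide) simp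
    then show "((\<lambda>x. x ^ Suc k / real (Suc k)) has_vector_derivative x ^ k) (at x within {0..h})"
      by (simp add: has_real_derivative_iff_has_vector_derivative[symmetric] del: of_nat_Suc)
  qed
  then show ?thesis by simp
qed

text \<open>Homogeneity: on x^k the error of the formula is exactly e * h^(k+1), where
  \<open>e\<close> is its defect on the unit interval. For k < q this can be O(h^(q+1)) only if e =
  0.\<close>

lemma quadrature_order_exact_on_monomials:
  assumes "quadrature_order n b c q" "k < q"
  shows "(\<Sum>i\<le>n. b i * c i ^ k) = 1 / real (Suc k)"
proof -
  define e where "e = 1 / real (Suc k) - (\<Sum>i\<le>n. b i * c i ^ k)"
  obtain m where m: "\<And>f :: real \<Rightarrow> real. C_k_on m UNIV f \<Longrightarrow>
        (\<lambda>h. integral {0..h} f - h * (\<Sum>i\<le>n. b i * f (c i * h))) \<in> O[at_right 0](\<lambda>h. h ^ (q + 1))"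
    using assms(1) unfolding quadrature_order_def by blast
  have eq: "integral {0..h} (\<lambda>x. x ^ k) - h * (\<Sum>i\<le>n. b i * (c i * h) ^ k) = e * h ^ Suc k"
    if "h > 0" for h :: real
  proof -
    have "integral {0..h} (\<lambda>x. x ^ k) = h ^ Suc k / real (Suc k)"
      using integral_power_Icc[of h k] that by (intro integral_unique) auto
    moreover have "h * (\<Sum>i\<le>n. b i * (c i * h) ^ k) = (\<Sum>i\<le>n. b i * c i ^ k) * h ^ Suc k"
      by (simp add: sum_distrib_left sum_distrib_right power_mult_distrib mult_ac)
    ultimately show ?thesis by (simp only: e_def left_diff_distrib) simp
  qed
  have "(\<lambda>h. integral {0..h} (\<lambda>x. x ^ k) - h * (\<Sum>i\<le>n. b i * (c i * h) ^ k))
          \<in> O[at_right 0](\<lambda>h. h ^ (q + 1))"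
    using m[of "\<lambda>x. x ^ k"] C_k_on_monomial[of m 1 k] by simp
  then obtain K where "eventually (\<lambda>h. norm (integral {0..h} (\<lambda>x. x ^ k) - h * (\<Sum>i\<le>n. b i * (c i * h) ^ k))
      \<le> K * norm (h ^ (q + 1))) (at_right 0)"
    by (elim landau_o.bigE)
  \<comment> \<open>Dividing by h^(k+1) leaves a positive power of \<open>h\<close> on the right, so
    the limit from the right at 0 yields e = 0.\<close>
  then have ev: "eventually (\<lambda>h. \<bar>e\<bar> \<le> K * h ^ (q - k)) (at_right (0::real))"
    using eventually_at_right_less[of 0]
  proof eventually_elim
    case (elim h)
    then have "\<bar>e\<bar> * h ^ Suc k \<le> K * h ^ (q + 1)"
      using eq[of h] by (simp add: abs_mult)
    also have "h ^ (q + 1) = h ^ (q - k) * h ^ Suc k"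
      using assms(2) by (simp flip: power_add)
    finally show ?case using elim by (simp add: field_simps)
  qed
  have "((\<lambda>h::real. K * h ^ (q - k)) \<longlongrightarrow> K * 0 ^ (q - k)) (at_right 0)"
    by (intro tendsto_intros)
  then have "\<bar>e\<bar> \<le> K * 0 ^ (q - k)"
    by (rule tendsto_lowerbound[OF _ ev]) auto
  then have "e = 0" using assms(2) by (simp add: zero_power)
  then show ?thesis by (simp add: e_def)
qed

text \<open>Taylor expansion at the left end point, where the derivatives are one-sided. The
  quadrature formula is exact on every polynomial of degree below its order, so the coefficients can
  remain unspecified.\<close>

lemma C_k_bounded_by_Taylor:
  assumes "C_k_bounded_by k B {0..h} f"
  shows "\<exists>a. \<forall>t\<in>{0..h}. \<bar>f t - (\<Sum>m<k. a m * t ^ m)\<bar> \<le> B * t ^ k"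
proof (cases k)
  case 0
  then show ?thesis using assms by (auto simp: C_k_bounded_by_def)
next
  case (Suc l)
  show ?thesis
  proof (cases "0 \<le> h")
    case True
    obtain g :: "nat \<Rightarrow> real \<Rightarrow> real" where g0: "\<And>t. t \<in> {0..h} \<Longrightarrow> g 0 t = f t"
      and g: "\<And>m t. m < k \<Longrightarrow> t \<in> {0..h} \<Longrightarrow> (g m has_real_derivative g (Suc m) t) (at t within {0..h})"
      and gB: "\<And>m t. m \<le> k \<Longrightarrow> t \<in> {0..h} \<Longrightarrow> \<bar>g m t\<bar> \<le> B"
      using assms unfolding C_k_bounded_by_def by blast
    have "\<bar>f t - (\<Sum>m<k. (g m 0 / fact m) * t ^ m)\<bar> \<le> B * t ^ k" if t: "t \<in> {0..h}" for t
    proof -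
      have "norm (g 0 t - (\<Sum>m\<le>l. g m 0 * (t - 0) ^ m / fact m)) \<le> B * norm (t - 0) ^ Suc l / fact l"
        using True t g gB Suc by (intro field_Taylor[of "{0..h}"]) auto
      moreover have "B \<ge> 0" using gB[of 0 t] t by simp
      then have "B * t ^ Suc l / fact l \<le> B * t ^ Suc l"
        using t divide_left_mono[of 1 "fact l" "B * t ^ Suc l"] by simp
      ultimately show ?thesis
        using g0[OF t] t Suc by (simp add: lessThan_Suc_atMost)
    qed
    then show ?thesis by (intro exI[of _ "\<lambda>m. g m 0 / fact m"]) blast
  qed auto
qed

text \<open>The error functional vanishes on polynomials of degree below \<open>q\<close>, so the
  error for \<open>f\<close> is the error for its Taylor remainder, which is at most B * h^q on the
  interval. The integral and the weighted sum each add a factor \<open>h\<close>. The constant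
  depends on \<open>f\<close> only through \<open>B\<close>, so it also serves integrands that vary
  with \<open>h\<close>.\<close>

lemma quadrature_error_bound:
  assumes quad: "quadrature_order n b c q" and c: "\<And>i. i \<le> n \<Longrightarrow> c i \<in> {0..1}"
    and h: "h \<ge> 0" and f: "C_k_bounded_by q B {0..h} f"
  shows "\<bar>integral {0..h} f - h * (\<Sum>i\<le>n. b i * f (c i * h))\<bar> \<le> B * (1 + (\<Sum>i\<le>n. \<bar>b i\<bar>)) * h ^ (q + 1)"
proof -
  obtain a where a: "\<And>t. t \<in> {0..h} \<Longrightarrow> \<bar>f t - (\<Sum>m<q. a m * t ^ m)\<bar> \<le> B * t ^ q"
    using C_k_bounded_by_Taylor[OF f] by blast
  define P where "P t = (\<Sum>m<q. a m * t ^ m)" for t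
  obtain g :: "nat \<Rightarrow> real \<Rightarrow> real" where g: "\<forall>t\<in>{0..h}. g 0 t = f t"
    and gB: "\<forall>m\<le>q. continuous_on {0..h} (g m) \<and> (\<forall>t\<in>{0..h}. \<bar>g m t\<bar> \<le> B)"
    using f unfolding C_k_bounded_by_def by blast
  have fc: "continuous_on {0..h} f"
    by (rule continuous_on_eq[of _ "g 0"]) (use g gB in auto)
  have B: "B \<ge> 0" using gB[rule_format, of 0] h by force
  have RB: "\<bar>f t - P t\<bar> \<le> B * h ^ q" if "t \<in> {0..h}" for t
  proof -
    have "B * t ^ q \<le> B * h ^ q" using that B by (intro mult_left_mono power_mono) auto
    then show ?thesis using a[OF that] by (simp add: P_def)
  qed
  have ch: "c i * h \<in> {0..h}" if "i \<le> n" for i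
    using c[OF that] h by (auto intro: mult_left_le_one_le)
  have IP: "(P has_integral (\<Sum>m<q. a m * (h ^ Suc m / real (Suc m)))) {0..h}"
    unfolding P_def by (intro has_integral_sum has_integral_mult_right integral_power_Icc h) auto
  have QP: "h * (\<Sum>i\<le>n. b i * P (c i * h)) = (\<Sum>m<q. a m * (h ^ Suc m / real (Suc m)))"
  proof -
    have "h * (\<Sum>i\<le>n. b i * P (c i * h)) = (\<Sum>i\<le>n. \<Sum>m<q. a m * h ^ Suc m * (b i * c i ^ m))"
      by (simp add: P_def sum_distrib_left power_mult_distrib mult_ac)
    also have "\<dots> = (\<Sum>m<q. a m * h ^ Suc m * (\<Sum>i\<le>n. b i * c i ^ m))"
      by (subst sum.swap) (simp add: sum_distrib_left)
    also have "\<dots> = (\<Sum>m<q. a m * (h ^ Suc m / real (Suc m)))"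
      by (intro sum.cong) (auto simp: quadrature_order_exact_on_monomials[OF quad])
    finally show ?thesis .
  qed
  have fI: "f integrable_on {0..h}" by (rule integrable_continuous_real[OF fc])
  have "integral {0..h} f - h * (\<Sum>i\<le>n. b i * f (c i * h))
      = integral {0..h} (\<lambda>t. f t - P t) - h * (\<Sum>i\<le>n. b i * (f (c i * h) - P (c i * h)))"
    using IP QP fI by (subst integral_diff)
      (auto simp: integral_unique has_integral_integrable right_diff_distrib sum_subtractf)
  also have "\<bar>\<dots>\<bar> \<le> B * h ^ q * h + h * (\<Sum>i\<le>n. \<bar>b i\<bar> * (B * h ^ q))"
  proof -
    have "norm (integral {0..h} (\<lambda>t. f t - P t)) \<le> B * h ^ q * (h - 0)"
    proof (rule integral_bound)
      show "continuous_on {0..h} (\<lambda>t. f t - P t)"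
        unfolding P_def by (intro continuous_intros fc)
    qed (use h RB in auto)
    moreover have "\<bar>\<Sum>i\<le>n. b i * (f (c i * h) - P (c i * h))\<bar> \<le> (\<Sum>i\<le>n. \<bar>b i\<bar> * (B * h ^ q))"
      by (rule order_trans[OF sum_abs sum_mono])
         (auto simp: abs_mult intro!: mult_left_mono RB ch)
    then have "\<bar>h * (\<Sum>i\<le>n. b i * (f (c i * h) - P (c i * h)))\<bar> \<le> h * (\<Sum>i\<le>n. \<bar>b i\<bar> * (B * h ^ q))"
      using h by (simp add: abs_mult mult_left_mono)
    ultimately show ?thesis by (smt (verit) real_norm_def)
  qed
  also have "\<dots> = B * (1 + (\<Sum>i\<le>n. \<bar>b i\<bar>)) * h ^ (q + 1)"
    by (simp add: distrib_left distrib_right sum_distrib_left sum_distrib_right mult_ac)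
  finally show ?thesis .
qed

section \<open>Error propagation for second-order equations\<close>

lemma norm_vector_derivative_bound:
  fixes f :: "real \<Rightarrow> 'b::real_normed_vector"
  assumes "\<And>t. t \<in> {a..b} \<Longrightarrow> (f has_vector_derivative f' t) (at t within {a..b})"
    and "\<And>t. t \<in> {a..b} \<Longrightarrow> norm (f' t) \<le> B" and "s \<in> {a..b}" "t \<in> {a..b}"
  shows "norm (f t - f s) \<le> B * \<bar>t - s\<bar>"
proof -
  have "norm (f t - f s) \<le> B * norm (t - s)"
  proof (rule differentiable_bound[of "{a..b}" f "\<lambda>t h. h *\<^sub>R f' t"])
    show "onorm (\<lambda>h. h *\<^sub>R f' x) \<le> B" if "x \<in> {a..b}" for x
      using assms(2)[OF that] by (intro onorm_le) (simp add: mult.commute[of B] mult_left_mono)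
  qed (use assms in \<open>auto simp: has_vector_derivative_def\<close>)
  then show ?thesis by simp
qed

text \<open>The velocity difference changes at a rate of at most M |d|, hence by O(s). Integrating
  once more leaves O(s^2) in the positions after the drift \<open>s *\<^sub>R snd (d 0)\<close> is
  removed. This quadratic remainder is what later allows an initial velocity error to be recovered
  from the end positions.\<close>

lemma second_order_ode_comparison:
  fixes X Y :: "real \<Rightarrow> 'a::real_normed_vector \<times> 'a"
  assumes X: "\<forall>t\<in>{0..s}. X t \<in> D \<and> (X has_vector_derivative (snd (X t), F (X t))) (at t within {0..s})"
    and Y: "\<forall>t\<in>{0..s}. Y t \<in> D \<and> (Y has_vector_derivative (snd (Y t), F (Y t))) (at t within {0..s})"
    and F: "M-lipschitz_on D F" and s: "0 \<le> s" "s * (1 + M) \<le> 1 / 2"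
  defines "d \<equiv> \<lambda>t. X t - Y t"
  shows "norm (d s) \<le> 2 * norm (d 0)"
    and "norm (snd (d s) - snd (d 0)) \<le> 2 * M * s * norm (d 0)"
    and "norm (fst (d s) - fst (d 0) - s *\<^sub>R snd (d 0)) \<le> 2 * M * s\<^sup>2 * norm (d 0)"
proof -
  define d' where "d' t = (snd (d t), F (X t) - F (Y t))" for t
  have M: "M \<ge> 0" using F by (rule lipschitz_on_nonneg)
  have der: "(d has_vector_derivative d' t) (at t within {0..s})" if "t \<in> {0..s}" for t
    using has_vector_derivative_diff[of X _ _ Y] X Y that
    unfolding d_def d'_def by (metis (no_types, lifting) diff_Pair snd_diff)
  have LF: "norm (F (X t) - F (Y t)) \<le> M * norm (d t)" if "t \<in> {0..s}" for t
    using lipschitz_onD[OF F, of "X t" "Y t"] X Y that by (simp add: dist_norm d_def)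
  have "continuous_on {0..s} d"
    using der has_vector_derivative_continuous continuous_on_eq_continuous_within by blast
  then have "continuous_on {0..s} (\<lambda>t. norm (d t))" by (intro continuous_intros)
  \<comment> \<open>Absorption in place of Gronwall's inequality: the maximum \<open>R\<close> of
    |d| satisfies R \<le> |d 0| + s (1 + M) R, and the last term is at most R / 2.\<close>
  then obtain u where u: "u \<in> {0..s}" "\<And>t. t \<in> {0..s} \<Longrightarrow> norm (d t) \<le> norm (d u)"
    using continuous_attains_sup[of "{0..s}" "\<lambda>t. norm (d t)"] s by auto
  define R where "R = norm (d u)"
  have "norm (d' t) \<le> (1 + M) * R" if t: "t \<in> {0..s}" for t
  proof -
    have "norm (d' t) \<le> norm (snd (d t)) + norm (F (X t) - F (Y t))"
      unfolding d'_def by (rule norm_Pair_le)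
    also have "\<dots> \<le> norm (d t) + M * norm (d t)"
      using LF[OF t] norm_snd_le[of "snd (d t)" "fst (d t)"] by simp
    also have "\<dots> \<le> R + M * R"
      using u(2)[OF t] M by (intro add_mono mult_left_mono) (auto simp: R_def)
    finally show ?thesis by (simp add: algebra_simps)
  qed
  then have "norm (d u - d 0) \<le> (1 + M) * R * \<bar>u - 0\<bar>"
    using der u s by (intro norm_vector_derivative_bound[of 0 s d d']) auto
  also have "\<dots> \<le> (1 + M) * R * s"
    using u M by (intro mult_left_mono) (auto simp: R_def)
  also have "\<dots> \<le> 1 / 2 * R"
    using mult_right_mono[OF s(2), of R] by (simp add: R_def mult_ac)
  finally have "R \<le> 2 * norm (d 0)"
    using norm_triangle_ineq2[of "d u" "d 0"] by (simp add: R_def)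
  then have bd: "norm (d t) \<le> 2 * norm (d 0)" if "t \<in> {0..s}" for t
    using u(2)[OF that] by (simp add: R_def)
  then show "norm (d s) \<le> 2 * norm (d 0)" using s by auto
  have ds: "((\<lambda>t. snd (d t)) has_vector_derivative snd (d' t)) (at t within {0..s})"
    and df: "((\<lambda>t. fst (d t)) has_vector_derivative snd (d t)) (at t within {0..s})" if "t \<in> {0..s}" for t
    using bounded_linear.has_vector_derivative[OF bounded_linear_snd der[OF that]]
      bounded_linear.has_vector_derivative[OF bounded_linear_fst der[OF that]]
    by (simp_all add: d'_def)
  have B1: "norm (snd (d t) - snd (d 0)) \<le> 2 * M * s * norm (d 0)" if t: "t \<in> {0..s}" for t
  proof -
    have "norm (snd (d' r)) \<le> 2 * M * norm (d 0)" if "r \<in> {0..s}" for r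
      using LF[OF that] mult_left_mono[OF bd[OF that] M] by (simp add: d'_def)
    then have "norm (snd (d t) - snd (d 0)) \<le> 2 * M * norm (d 0) * \<bar>t - 0\<bar>"
      using ds s t by (intro norm_vector_derivative_bound[of 0 s _ "\<lambda>t. snd (d' t)"]) auto
    also have "\<dots> \<le> 2 * M * norm (d 0) * s"
      using t M by (intro mult_left_mono) auto
    finally show ?thesis by (simp add: mult_ac)
  qed
  then show "norm (snd (d s) - snd (d 0)) \<le> 2 * M * s * norm (d 0)" using s by auto
  \<comment> \<open>The mean value inequality is applied to the position difference with its linear
    drift removed; the derivative of that function is the velocity change bounded in
    \<open>B1\<close>.\<close>
  have "norm ((fst (d s) - s *\<^sub>R snd (d 0)) - (fst (d 0) - 0 *\<^sub>R snd (d 0))) \<le> 2 * M * s * norm (d 0) * \<bar>s - 0\<bar>"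
  proof (rule norm_vector_derivative_bound)
    fix t assume t: "t \<in> {0..s}"
    show "((\<lambda>t. fst (d t) - t *\<^sub>R snd (d 0)) has_vector_derivative snd (d t) - snd (d 0)) (at t within {0..s})"
      using df[OF t] by (auto intro!: derivative_eq_intros)
    show "norm (snd (d t) - snd (d 0)) \<le> 2 * M * s * norm (d 0)" by (rule B1[OF t])
  qed (use s in auto)
  then show "norm (fst (d s) - fst (d 0) - s *\<^sub>R snd (d 0)) \<le> 2 * M * s\<^sup>2 * norm (d 0)"
    using s by (simp add: algebra_simps power2_eq_square)
qed

section \<open>Error recurrences with vanishing positions at both ends\<close>

lemma nodes_in_unit_interval:
  fixes c :: "nat \<Rightarrow> real"
  assumes "c 0 = 0" "c n = 1" and step: "\<And>i. i < n \<Longrightarrow> c i \<le> c (Suc i)" and "j \<le> n"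
  shows "c j \<in> {0..1}"
proof -
  have mono: "c k \<le> c j" if "k \<le> j" "j \<le> n" for k j
    using that by (induction j) (auto simp: le_Suc_eq Suc_le_eq intro: order_trans[OF _ step])
  show ?thesis using mono[of 0 j] mono[of j n] assms by auto
qed

text \<open>A discrete boundary-value problem. Forward induction expresses all errors through the
  initial velocity error V = |snd (e 0)|. At the last node the leading position term
  \<open>h *\<^sub>R snd (e 0)\<close> has to be cancelled by a remainder O(h^2 V) + O(h^(p+1)),
  which bounds V by a multiple of h^p.\<close>

lemma two_point_error_recurrence:
  fixes c :: "nat \<Rightarrow> real"
  assumes c: "c 0 = 0" "c n = 1" "\<And>i. i < n \<Longrightarrow> c i \<le> c (Suc i)" and K: "K \<ge> 0"
  shows "\<exists>K'. \<exists>h0>0. \<forall>(e :: nat \<Rightarrow> 'a::real_normed_vector \<times> 'a) h.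
     0 < h \<and> h \<le> h0 \<and> fst (e 0) = 0 \<and> fst (e n) = 0 \<and>
     (\<forall>i<n. norm (snd (e (Suc i)) - snd (e i)) \<le> K * (h * norm (e i) + h ^ (p + 1)) \<and>
            norm (fst (e (Suc i)) - fst (e i) - ((c (Suc i) - c i) * h) *\<^sub>R snd (e i))
              \<le> K * (h\<^sup>2 * norm (e i) + h ^ (p + 1))) \<longrightarrow>
     (\<forall>i\<le>n. norm (e i) \<le> K' * h ^ p)"
proof -
  have c01: "0 \<le> c i" "c i \<le> 1" if "i \<le> n" for i
    using nodes_in_unit_interval[of c n i] c that by auto
  define P where "P e h \<longleftrightarrow> 0 < h \<and> h \<le> 1 \<and> fst (e 0) = 0 \<and>
     (\<forall>i<n. norm (snd (e (Suc i)) - snd (e i)) \<le> K * (h * norm (e i) + h ^ (p + 1)) \<and>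
            norm (fst (e (Suc i)) - fst (e i) - ((c (Suc i) - c i) * h) *\<^sub>R snd (e i))
              \<le> K * (h\<^sup>2 * norm (e i) + h ^ (p + 1)))" for e :: "nat \<Rightarrow> 'a \<times> 'a" and h
  define V where "V e = norm (snd (e 0))" for e :: "nat \<Rightarrow> 'a \<times> 'a"
  \<comment> \<open>The target of the forward induction. With the drift split off, the position
    bound carries h^2 where the velocity bound carries \<open>h\<close>.\<close>
  define G where "G J e h i \<longleftrightarrow>
      norm (snd (e i) - snd (e 0)) \<le> J * (h * V e + h ^ (p + 1)) \<and>
      norm (fst (e i) - (c i * h) *\<^sub>R snd (e 0)) \<le> J * (h\<^sup>2 * V e + h ^ (p + 1))"
    for J h and e :: "nat \<Rightarrow> 'a \<times> 'a" and i
  have size: "norm (e i) \<le> (2 + 2 * J) * V e + 2 * J * h ^ (p + 1)"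
    if G: "G J e h i" and P: "P e h" and i: "i \<le> n" and J: "J \<ge> 0" for J e h i
  proof -
    have h: "0 < h" "h \<le> 1" using P by (auto simp: P_def)
    have hV: "h * V e \<le> V e" "h\<^sup>2 * V e \<le> V e"
      using h power_le_one[of h 2] by (simp_all add: V_def mult_left_le_one_le)
    have "norm (snd (e i)) \<le> V e + J * (V e + h ^ (p + 1))"
    proof -
      have "J * (h * V e + h ^ (p + 1)) \<le> J * (V e + h ^ (p + 1))"
        using hV J by (intro mult_left_mono) auto
      then show ?thesis
        using G norm_triangle_sub[of "snd (e i)" "snd (e 0)"] by (auto simp: G_def V_def)
    qed
    moreover have "norm (fst (e i)) \<le> V e + J * (V e + h ^ (p + 1))"
    proof -
      have "J * (h\<^sup>2 * V e + h ^ (p + 1)) \<le> J * (V e + h ^ (p + 1))"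
        using hV J by (intro mult_left_mono) auto
      moreover have "norm ((c i * h) *\<^sub>R snd (e 0)) \<le> V e"
        using c01[OF i] h by (auto simp: V_def abs_mult intro!: mult_left_le_one_le mult_le_one)
      ultimately show ?thesis
        using G norm_triangle_sub[of "fst (e i)" "(c i * h) *\<^sub>R snd (e 0)"] by (auto simp: G_def)
    qed
    moreover have "norm (e i) \<le> norm (fst (e i)) + norm (snd (e i))"
      using norm_Pair_le[of "fst (e i)" "snd (e i)"] by simp
    ultimately show ?thesis by (simp add: algebra_simps)
  qed
  \<comment> \<open>The constant may grow from node to node, since the number of nodes is fixed, but
    it is chosen before \<open>e\<close> and \<open>h\<close>, which makes the bound
    uniform.\<close>
  have "\<exists>J\<ge>0. \<forall>e h. P e h \<longrightarrow> G J e h i" if "i \<le> n" for i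
    using that
  proof (induction i)
    case 0
    have "G 0 e h 0" if "P e h" for e h
      using that c by (simp add: G_def P_def)
    then show ?case by blast
  next
    case (Suc i)
    then obtain J where J: "J \<ge> 0" "\<And>e h. P e h \<Longrightarrow> G J e h i" by auto
    \<comment> \<open>One \<open>J\<close> is inherited from node \<open>i\<close>, a second one
      pays for replacing \<open>snd (e i)\<close> by \<open>snd (e 0)\<close> in the drift, and K (3
      + 2 J) bounds the new recurrence error by means of \<open>size\<close>.\<close>
    define J' where "J' = 2 * J + K * (3 + 2 * J)"
    have "G J' e h (Suc i)" if P: "P e h" for e h
    proof -
      have h: "0 < h" "h \<le> 1" using P by (auto simp: P_def)
      define E where "E = h ^ (p + 1)"
      have E: "E \<ge> 0" using h by (simp add: E_def)
      have V: "V e \<ge> 0" by (simp add: V_def)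
      have hE: "h * E \<le> E" "h\<^sup>2 * E \<le> E"
        using h E power_le_one[of h 2] by (simp_all add: mult_left_le_one_le)
      have Gi: "norm (snd (e i) - snd (e 0)) \<le> J * (h * V e + E)"
        "norm (fst (e i) - (c i * h) *\<^sub>R snd (e 0)) \<le> J * (h\<^sup>2 * V e + E)"
        using J(2)[OF P] by (auto simp: G_def E_def)
      have sz: "norm (e i) \<le> (2 + 2 * J) * V e + 2 * J * E"
        using size[OF J(2)[OF P] P _ J(1)] Suc.prems by (simp add: E_def)
      have st: "norm (snd (e (Suc i)) - snd (e i)) \<le> K * (h * norm (e i) + E)"
        "norm (fst (e (Suc i)) - fst (e i) - ((c (Suc i) - c i) * h) *\<^sub>R snd (e i))
              \<le> K * (h\<^sup>2 * norm (e i) + E)"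
        using P Suc.prems by (auto simp: P_def E_def)
      \<comment> \<open>Used with \<open>g = h\<close> for the velocities and with
        \<open>g = h\<^sup>2\<close> for the positions.\<close>
      have bnd: "K * (g * norm (e i) + E) \<le> K * (3 + 2 * J) * (g * V e + E)"
        if g: "0 \<le> g" "g * E \<le> E" for g
      proof -
        have "g * norm (e i) + E \<le> (2 + 2 * J) * (g * V e) + (2 * J + 1) * E"
        proof -
          have "g * norm (e i) \<le> g * ((2 + 2 * J) * V e + 2 * J * E)"
            using sz g by (intro mult_left_mono) auto
          also have "\<dots> = (2 + 2 * J) * (g * V e) + 2 * J * (g * E)" by (simp add: algebra_simps)
          also have "\<dots> \<le> (2 + 2 * J) * (g * V e) + 2 * J * E"
            using g J by (intro add_left_mono mult_left_mono) auto
          finally show ?thesis by (simp add: algebra_simps)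
        qed
        also have "\<dots> \<le> (3 + 2 * J) * (g * V e) + (3 + 2 * J) * E"
          using g V E J by - (rule add_mono; rule mult_right_mono; simp)
        finally show ?thesis
          using K by (simp add: mult.assoc mult_left_mono flip: distrib_left)
      qed
      have "norm (snd (e (Suc i)) - snd (e 0)) \<le> J * (h * V e + E) + K * (3 + 2 * J) * (h * V e + E)"
        using norm_triangle_ineq[of "snd (e (Suc i)) - snd (e i)" "snd (e i) - snd (e 0)"] st(1) Gi(1)
          bnd[of h] h hE by simp
      also have "\<dots> \<le> J' * (h * V e + E)"
        using J V E h by (simp add: J'_def algebra_simps)
      finally have 1: "norm (snd (e (Suc i)) - snd (e 0)) \<le> J' * (h * V e + E)" .
      define s where "s = (c (Suc i) - c i) * h"
      have s: "0 \<le> s" "s \<le> h"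
        using c(3)[of i] c01[of i] c01[of "Suc i"] Suc.prems h
        by (auto simp: s_def intro!: mult_left_le_one_le)
      have eq: "fst (e (Suc i)) - (c (Suc i) * h) *\<^sub>R snd (e 0) =
          (fst (e (Suc i)) - fst (e i) - s *\<^sub>R snd (e i)) + (fst (e i) - (c i * h) *\<^sub>R snd (e 0))
          + s *\<^sub>R (snd (e i) - snd (e 0))"
        by (simp add: s_def algebra_simps)
      have "norm (fst (e (Suc i)) - (c (Suc i) * h) *\<^sub>R snd (e 0)) \<le>
          K * (h\<^sup>2 * norm (e i) + E) + J * (h\<^sup>2 * V e + E) + h * (J * (h * V e + E))"
        unfolding eq
      proof (intro order_trans[OF norm_triangle_ineq] add_mono)
        show "norm (s *\<^sub>R (snd (e i) - snd (e 0))) \<le> h * (J * (h * V e + E))"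
          using s Gi(1) by (simp add: mult_mono)
      qed (use st(2) Gi(2) in \<open>simp_all add: s_def\<close>)
      also have "\<dots> \<le> K * (3 + 2 * J) * (h\<^sup>2 * V e + E) + J * (h\<^sup>2 * V e + E) + J * (h\<^sup>2 * V e + E)"
      proof (intro add_mono order_refl)
        show "K * (h\<^sup>2 * norm (e i) + E) \<le> K * (3 + 2 * J) * (h\<^sup>2 * V e + E)"
          using bnd[of "h\<^sup>2"] hE by simp
        have "h * (J * (h * V e + E)) = J * (h\<^sup>2 * V e + h * E)"
          by (simp add: algebra_simps power2_eq_square)
        also have "\<dots> \<le> J * (h\<^sup>2 * V e + E)"
          using hE J by (intro mult_left_mono) auto
        finally show "h * (J * (h * V e + E)) \<le> J * (h\<^sup>2 * V e + E)" .
      qed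
      also have "\<dots> = J' * (h\<^sup>2 * V e + E)"
        by (simp add: J'_def algebra_simps)
      finally show ?thesis using 1 by (simp add: G_def E_def)
    qed
    moreover have "J' \<ge> 0" using J K by (simp add: J'_def)
    ultimately show ?case by blast
  qed
  then obtain J where J: "\<And>i. i \<le> n \<Longrightarrow> J i \<ge> 0" "\<And>i e h. i \<le> n \<Longrightarrow> P e h \<Longrightarrow> G (J i) e h i"
    by metis
  define S where "S = (\<Sum>i\<le>n. J i)"
  have JS: "J i \<le> S" if "i \<le> n" for i
    unfolding S_def using that J by (intro member_le_sum) auto
  have S: "S \<ge> 0" using J JS by (meson order_trans order_refl)
  have GS: "G S e h i" if "i \<le> n" "P e h" for e h i
  proof -
    have "0 \<le> h * V e + h ^ (p + 1)" "0 \<le> h\<^sup>2 * V e + h ^ (p + 1)"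
      using that by (auto simp: P_def V_def)
    then show ?thesis
      using J(2)[OF that] JS[OF that(1)] unfolding G_def by (meson mult_right_mono order_trans)
  qed
  \<comment> \<open>Makes S * h at most 1/2, so that the term S h^2 V can be absorbed into the
    left-hand side h V.\<close>
  define h0 where "h0 = 1 / (2 * S + 1)"
  have h0: "0 < h0" "h0 \<le> 1" using S by (auto simp: h0_def)
  have main: "norm (e i) \<le> ((2 + 2 * S) * (2 * S) + 2 * S) * h ^ p"
    if P: "P e h" and h: "h \<le> h0" and en: "fst (e n) = 0" and i: "i \<le> n" for e h i
  proof -
    have h1: "0 < h" "h \<le> 1" using P by (auto simp: P_def)
    \<comment> \<open>As \<open>c n = 1\<close> and \<open>fst (e n) = 0\<close>, the position bound
      at node \<open>n\<close> is a bound for h V itself. Cancelling the factor \<open>h\<close>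
      costs the one order.\<close>
    have "h * V e \<le> S * (h\<^sup>2 * V e + h ^ (p + 1))"
      using GS[OF order_refl P] en c h1 by (simp add: G_def V_def)
    also have "\<dots> = (S * h) * (h * V e) + S * h ^ p * h"
      by (simp add: algebra_simps power2_eq_square)
    also have "\<dots> \<le> 1 / 2 * (h * V e) + S * h ^ p * h"
    proof (rule add_right_mono, rule mult_right_mono)
      have "S * h \<le> S * h0" using S h by (intro mult_left_mono)
      also have "\<dots> \<le> 1 / 2" using S by (simp add: h0_def field_simps)
      finally show "S * h \<le> 1 / 2" .
    qed (use h1 in \<open>simp add: V_def\<close>)
    finally have "h * V e \<le> (2 * S * h ^ p) * h" by simp
    then have V: "V e \<le> 2 * S * h ^ p" using h1 by (simp add: mult.commute)
    have "norm (e i) \<le> (2 + 2 * S) * V e + 2 * S * h ^ (p + 1)"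
      using size[OF GS[OF i P] P i S] .
    also have "\<dots> \<le> (2 + 2 * S) * (2 * S * h ^ p) + 2 * S * h ^ p"
      using V S h1 by (intro add_mono mult_left_mono) (auto intro: mult_left_le_one_le)
    finally show ?thesis by (simp add: algebra_simps)
  qed
  show ?thesis
  proof (rule exI[of _ "(2 + 2 * S) * (2 * S) + 2 * S"], rule exI[of _ h0], intro conjI allI impI h0)
    fix e :: "nat \<Rightarrow> 'a \<times> 'a" and h i
    assume *: "0 < h \<and> h \<le> h0 \<and> fst (e 0) = 0 \<and> fst (e n) = 0 \<and>
     (\<forall>i<n. norm (snd (e (Suc i)) - snd (e i)) \<le> K * (h * norm (e i) + h ^ (p + 1)) \<and>
            norm (fst (e (Suc i)) - fst (e i) - ((c (Suc i) - c i) * h) *\<^sub>R snd (e i))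
              \<le> K * (h\<^sup>2 * norm (e i) + h ^ (p + 1)))" and "i \<le> n"
    moreover have "P e h" unfolding P_def using * h0 by auto
    ultimately show "norm (e i) \<le> ((2 + 2 * S) * (2 * S) + 2 * S) * h ^ p"
      by (intro main) auto
  qed
qed

section \<open>The tangent bundle in charts\<close>

text \<open>Lets the lemmas in one chart be stated for a fixed \<open>F\<close>, extracted once from
  the existential quantifier in \<open>EL_second_order\<close>.\<close>

definition EL_acceleration ::
    "('i, 'm, 'a::euclidean_space) atlas \<Rightarrow> ('m \<times> ('i \<Rightarrow> 'a) \<Rightarrow> real) \<Rightarrow> 'i \<Rightarrow>
     ('a \<times> 'a \<Rightarrow> 'a) \<Rightarrow> bool" where
  "EL_acceleration A L i F \<longleftrightarrow>
     (\<forall>T>0. \<forall>y. y ` {0..T} \<subseteq> cmap A i ` cdom A i \<longrightarrow>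
        euler_lagrange (local_lagrangian A L i) {0..T} y \<longrightarrow> second_order_ode F {0..T} y)"

context
  fixes A :: "('i, 'm::{t2_space,second_countable_topology}, 'a::euclidean_space) atlas"
  assumes smooth: "smooth_atlas A"
begin

lemma chart_covers: "\<exists>i. x \<in> cdom A i"
  using smooth unfolding smooth_atlas_def by blast

lemma open_cdom: "open (cdom A i)"
  and open_cimage: "open (cmap A i ` cdom A i)"
  and chart_homeomorphism: "homeomorphism (cdom A i) (cmap A i ` cdom A i) (cmap A i) (cinv A i)"
  using smooth unfolding smooth_atlas_def by blast+

lemma cinv_cmap: "x \<in> cdom A i \<Longrightarrow> cinv A i (cmap A i x) = x"
  using chart_homeomorphism[of i] by (auto simp: homeomorphism_def)

lemma cinv_in_cdom: "u \<in> cmap A i ` cdom A i \<Longrightarrow> cinv A i u \<in> cdom A i"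
  by (auto simp: cinv_cmap)

lemma continuous_on_cmap: "continuous_on (cdom A i) (cmap A i)"
  and continuous_on_cinv: "continuous_on (cmap A i ` cdom A i) (cinv A i)"
  using chart_homeomorphism[of i] by (auto simp: homeomorphism_def)

lemma open_cmap_image:
  assumes "open W"
  shows "open (cmap A i ` (cdom A i \<inter> W))"
proof -
  have "cmap A i ` (cdom A i \<inter> W) = cmap A i ` cdom A i \<inter> cinv A i -` W"
    by (auto simp: cinv_cmap)
  then show ?thesis
    using continuous_open_preimage[OF continuous_on_cinv open_cimage assms] by metis
qed

abbreviation transition_deriv :: "'i \<Rightarrow> 'i \<Rightarrow> 'm \<Rightarrow> 'a \<Rightarrow> 'a" where
  "transition_deriv i j x \<equiv> frechet_derivative (cmap A j \<circ> cinv A i) (at (cmap A i x))"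

lemma transition_has_derivative:
  assumes "x \<in> cdom A i" "x \<in> cdom A j"
  shows "(cmap A j \<circ> cinv A i has_derivative transition_deriv i j x) (at (cmap A i x))"
proof -
  have "C_k_on (Suc 0) (cmap A i ` (cdom A i \<inter> cdom A j)) (cmap A j \<circ> cinv A i)"
    using smooth unfolding smooth_atlas_def by blast
  then show ?thesis
    using assms by (simp add: frechet_derivative_works)
qed

lemma transition_deriv_refl:
  assumes "x \<in> cdom A i"
  shows "transition_deriv i i x v = v"
proof -
  have "(cmap A i \<circ> cinv A i has_derivative (\<lambda>v. v)) (at (cmap A i x))"
    by (rule has_derivative_transform_within_open[OF has_derivative_ident open_cimage[of i]])
       (use assms in \<open>auto simp: cinv_cmap\<close>)
  then show ?thesis using frechet_derivative_at by metis
qed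

text \<open>The cocycle condition, by the chain rule: the composed transition agrees with the direct
  one on the coordinate image of the overlap of charts \<open>i\<close> and \<open>j\<close>, which
  is open.\<close>

lemma transition_deriv_comp:
  assumes x: "x \<in> cdom A i" "x \<in> cdom A j" "x \<in> cdom A k"
  shows "transition_deriv j k x (transition_deriv i j x v) = transition_deriv i k x v"
proof -
  have "(cmap A k \<circ> cinv A j has_derivative transition_deriv j k x) (at ((cmap A j \<circ> cinv A i) (cmap A i x)))"
    using transition_has_derivative[OF x(2,3)] x by (simp add: cinv_cmap)
  then have "((cmap A k \<circ> cinv A j) \<circ> (cmap A j \<circ> cinv A i) has_derivative
      transition_deriv j k x \<circ> transition_deriv i j x) (at (cmap A i x))"
    by (rule diff_chain_at[OF transition_has_derivative[OF x(1,2)]])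
  then have "(cmap A k \<circ> cinv A i has_derivative transition_deriv j k x \<circ> transition_deriv i j x)
      (at (cmap A i x))"
    by (rule has_derivative_transform_within_open[OF _ open_cmap_image[OF open_cdom[of j], of i]])
       (use x in \<open>auto simp: cinv_cmap\<close>)
  then have "transition_deriv i k x = transition_deriv j k x \<circ> transition_deriv i j x"
    using frechet_derivative_at by metis
  then show ?thesis by simp
qed

text \<open>The transformation law in \<open>tangent_bundle\<close> determines all components from
  the one in chart \<open>i\<close>, and the normalization to 0 settles the charts that miss the
  point.\<close>

lemma inj_on_tmap: "inj_on (tmap A i) (tdom A i)"
proof (rule inj_onI)
  fix z w assume z: "z \<in> tdom A i" and w: "w \<in> tdom A i" and eq: "tmap A i z = tmap A i w"
  have x: "fst z = fst w"
    using z w eq cinv_cmap unfolding tdom_def tmap_def by (metis (no_types, lifting) Pair_inject mem_Collect_eq)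
  have "snd y j = (if fst y \<in> cdom A j then transition_deriv i j (fst y) (snd y i) else 0)"
    if "y \<in> tdom A i" for y j
  proof -
    have "(fst y, snd y) \<in> tangent_bundle A" "fst y \<in> cdom A i" using that by (auto simp: tdom_def)
    then show ?thesis unfolding tangent_bundle_def mem_Collect_eq case_prod_conv by (metis IntI)
  qed
  then have "snd z j = snd w j" for j
    using z w eq x by (simp add: tmap_def)
  then show "z = w" using x by (simp add: prod_eq_iff fun_eq_iff)
qed

text \<open>Coordinates in one chart extend to a tangent vector by transporting \<open>v\<close> to
  every chart around the point; the cocycle condition makes these components compatible.\<close>

lemma tmap_image: "tmap A i ` tdom A i = tcoords A i"
proof
  show "tmap A i ` tdom A i \<subseteq> tcoords A i"
    by (auto simp: tdom_def tmap_def tcoords_def)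
  show "tcoords A i \<subseteq> tmap A i ` tdom A i"
  proof
    fix u assume "u \<in> tcoords A i"
    then obtain x v where x: "x \<in> cdom A i" and u: "u = (cmap A i x, v)"
      by (auto simp: tcoords_def)
    define z where "z = (x, \<lambda>j. if x \<in> cdom A j then transition_deriv i j x v else 0)"
    have "z \<in> tdom A i"
      using x by (auto simp: tdom_def tangent_bundle_def z_def transition_deriv_comp)
    moreover have "tmap A i z = u"
      using x by (simp add: tmap_def z_def u transition_deriv_refl)
    ultimately show "u \<in> tmap A i ` tdom A i" by blast
  qed
qed

lemma local_lagrangian_tmap: "z \<in> tdom A i \<Longrightarrow> local_lagrangian A L i (tmap A i z) = L z"
  by (simp add: local_lagrangian_def inv_into_f_f[OF inj_on_tmap])

lemma open_tcoords: "open (tcoords A i)"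
  unfolding tcoords_def by (intro open_Times open_cimage open_UNIV)

section \<open>Topology and compact sets of the tangent bundle\<close>

lemma openin_tangent_chart: "open V \<Longrightarrow> openin (tangent_topology A) {z \<in> tdom A i. tmap A i z \<in> V}"
  unfolding tangent_topology_def by (rule topology_generated_by_Basis) blast

lemma topspace_tangent_topology: "topspace (tangent_topology A) = tangent_bundle A"
proof -
  have "tdom A i = {z \<in> tdom A i. tmap A i z \<in> UNIV}" for i by simp
  then have "\<Union> {{z \<in> tdom A i. tmap A i z \<in> V} |i V. open V} = (\<Union>i. tdom A i)"
    using open_UNIV by blast
  also have "\<dots> = tangent_bundle A"
    using chart_covers unfolding tdom_def by blast
  finally show ?thesis
    unfolding tangent_topology_def topology_generated_by_topspace .
qed

lemma continuous_map_tmap: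
  "continuous_map (subtopology (tangent_topology A) (tdom A i)) euclidean (tmap A i)"
proof (clarsimp simp: continuous_map_def)
  fix V :: "('a \<times> 'a) set" assume "open V"
  then show "openin (subtopology (tangent_topology A) (tdom A i))
      {z \<in> topspace (tangent_topology A). z \<in> tdom A i \<and> tmap A i z \<in> V}"
    using openin_tangent_chart[of V i] by (auto simp: openin_subtopology topspace_tangent_topology tdom_def
      intro!: exI[of _ "{z \<in> tdom A i. tmap A i z \<in> V}"])
qed

text \<open>The preimage of an open set is a union of generating sets, one for each chart, with the
  velocity left free. Continuity serves to restrict compact sets of tangent vectors to compact sets
  of base points and to cover them by finitely many charts.\<close>

lemma continuous_map_tangent_projection: "continuous_map (tangent_topology A) euclidean fst"
proof (clarsimp simp: continuous_map_def)
  fix W :: "'m set" assume W: "open W"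
  have "{z \<in> topspace (tangent_topology A). fst z \<in> W}
      = (\<Union>i. {z \<in> tdom A i. tmap A i z \<in> cmap A i ` (cdom A i \<inter> W) \<times> UNIV})"
  proof -
    have "z \<in> tangent_bundle A \<and> fst z \<in> W \<longleftrightarrow>
        (\<exists>i. z \<in> tdom A i \<and> tmap A i z \<in> cmap A i ` (cdom A i \<inter> W) \<times> UNIV)" for z
    proof
      assume "z \<in> tangent_bundle A \<and> fst z \<in> W"
      with chart_covers[of "fst z"] show "\<exists>i. z \<in> tdom A i \<and> tmap A i z \<in> cmap A i ` (cdom A i \<inter> W) \<times> UNIV"
        by (auto simp: tdom_def tmap_def)
    next
      assume "\<exists>i. z \<in> tdom A i \<and> tmap A i z \<in> cmap A i ` (cdom A i \<inter> W) \<times> UNIV"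
      then obtain i y where y: "z \<in> tdom A i" "cmap A i (fst z) = cmap A i y" "y \<in> cdom A i" "y \<in> W"
        by (auto simp: tmap_def)
      then have "fst z = y" by (metis (no_types, lifting) cinv_cmap mem_Collect_eq tdom_def)
      then show "z \<in> tangent_bundle A \<and> fst z \<in> W" using y by (simp add: tdom_def)
    qed
    then show ?thesis by (auto simp: topspace_tangent_topology)
  qed
  also have "openin (tangent_topology A) \<dots>"
    by (intro openin_Union ballI) (auto intro!: openin_tangent_chart open_Times open_cmap_image W)
  finally show "openin (tangent_topology A) {z \<in> topspace (tangent_topology A). fst z \<in> W}" .
qed

text \<open>\<open>C_k_on\<close> gives continuity in the base point for each fixed direction only;
  expanding the direction in the finite basis yields joint continuity.\<close>

lemma continuous_on_transition_deriv:
  "continuous_on (cmap A i ` (cdom A i \<inter> cdom A j) \<times> UNIV)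
     (\<lambda>u. frechet_derivative (cmap A j \<circ> cinv A i) (at (fst u)) (snd u))"
proof -
  let ?S = "cmap A i ` (cdom A i \<inter> cdom A j)" and ?f = "cmap A j \<circ> cinv A i"
  have "C_k_on (Suc 0) ?S ?f"
    using smooth unfolding smooth_atlas_def by blast
  then have c: "continuous_on ?S (\<lambda>a. frechet_derivative ?f (at a) v)" for v
    by simp
  have "frechet_derivative ?f (at (fst u)) (snd u)
      = (\<Sum>b\<in>Basis. (snd u \<bullet> b) *\<^sub>R frechet_derivative ?f (at (fst u)) b)" if u: "u \<in> ?S \<times> UNIV" for u
  proof -
    obtain x where x: "x \<in> cdom A i" "x \<in> cdom A j" "fst u = cmap A i x"
      using u by (auto simp: mem_Times_iff)
    define T where "T = frechet_derivative ?f (at (fst u))"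
    have "linear T"
      unfolding T_def x(3) by (rule has_derivative_linear[OF transition_has_derivative[OF x(1,2)]])
    then have "(\<Sum>b\<in>Basis. (snd u \<bullet> b) *\<^sub>R T b) = T (\<Sum>b\<in>Basis. (snd u \<bullet> b) *\<^sub>R b)"
      by (simp add: linear_sum linear_scale)
    then show ?thesis
      unfolding euclidean_representation T_def by (rule sym)
  qed
  moreover have "continuous_on (?S \<times> UNIV) (\<lambda>u. \<Sum>b\<in>Basis. (snd u \<bullet> b) *\<^sub>R frechet_derivative ?f (at (fst u)) b)"
    by (intro continuous_intros continuous_on_compose2[OF c]) auto
  ultimately show ?thesis by (subst continuous_on_cong[OF refl]) assumption+
qed

text \<open>Continuity has to be tested on generating sets from arbitrary charts \<open>j\<close>.
  In the coordinates of chart \<open>i\<close> such a set becomes the preimage of an open set under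
  \<open>f\<close>, the tangent map of the transition.\<close>

lemma continuous_map_inv_tmap:
  "continuous_map (top_of_set (tcoords A i)) (tangent_topology A) (inv_into (tdom A i) (tmap A i))"
  unfolding tangent_topology_def
proof (rule continuous_on_generated_topo)
  let ?g = "inv_into (tdom A i) (tmap A i)"
  have g: "?g u \<in> tdom A i" "tmap A i (?g u) = u" if "u \<in> tcoords A i" for u
    using that tmap_image by (metis inv_into_into, metis f_inv_into_f)
  show "?g ` topspace (top_of_set (tcoords A i)) \<subseteq> \<Union> {{z \<in> tdom A i. tmap A i z \<in> V} |i V. open V}"
  proof -
    have "{z \<in> tdom A i. tmap A i z \<in> UNIV} \<in> {{z \<in> tdom A i. tmap A i z \<in> V} |i V. open V}" by blast
    then show ?thesis using g(1) by (intro image_subsetI UnionI) auto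
  qed
  fix U assume "U \<in> {{z \<in> tdom A i. tmap A i z \<in> V} |i V. open V}"
  then obtain j V where V: "open V" and U: "U = {z \<in> tdom A j. tmap A j z \<in> V}" by blast
  define S where "S = cmap A i ` (cdom A i \<inter> cdom A j) \<times> (UNIV :: 'a set)"
  define f where "f u = ((cmap A j \<circ> cinv A i) (fst u), frechet_derivative (cmap A j \<circ> cinv A i) (at (fst u)) (snd u))"
    for u :: "'a \<times> 'a"
  have S: "open S" unfolding S_def by (intro open_Times open_cmap_image open_cdom open_UNIV)
  have "continuous_on (cmap A i ` (cdom A i \<inter> cdom A j)) (cmap A j \<circ> cinv A i)"
    by (intro continuous_on_compose continuous_on_subset[OF continuous_on_cinv] continuous_on_subset[OF continuous_on_cmap])
       (auto simp: cinv_cmap)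
  then have "continuous_on S f"
    unfolding f_def S_def using continuous_on_transition_deriv[of i j]
    by (intro continuous_on_Pair) (auto intro!: continuous_on_compose2[OF _ continuous_on_fst[OF continuous_on_id]])
  then have "open (S \<inter> f -` V)" by (rule continuous_open_preimage[OF _ S V])
  moreover have "?g -` U \<inter> topspace (top_of_set (tcoords A i)) = S \<inter> f -` V"
  proof -
    have "?g u \<in> U \<longleftrightarrow> u \<in> S \<and> f u \<in> V" if u: "u \<in> tcoords A i" for u
    proof -
      obtain x v where z: "?g u = (x, v)" by fastforce
      have x: "x \<in> cdom A i" "(x, v) \<in> tangent_bundle A" "u = (cmap A i x, v i)"
        using g[OF u] unfolding z by (auto simp: tdom_def tmap_def)
      have "u \<in> S \<longleftrightarrow> x \<in> cdom A j"
        using x by (auto simp: S_def) (metis cinv_cmap)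
      moreover have "f u = tmap A j (x, v)" if "x \<in> cdom A j"
      proof -
        have "v j = transition_deriv i j x (v i)"
          using x that unfolding tangent_bundle_def by blast
        then show ?thesis using x by (simp add: f_def tmap_def cinv_cmap)
      qed
      ultimately show ?thesis
        using x(2) unfolding U z by (auto simp: tdom_def)
    qed
    moreover have "S \<subseteq> tcoords A i" by (auto simp: S_def tcoords_def)
    ultimately show ?thesis unfolding topspace_euclidean_subtopology by blast
  qed
  ultimately show "openin (top_of_set (tcoords A i)) (?g -` U \<inter> topspace (top_of_set (tcoords A i)))"
    by (simp only:) (intro open_subset, auto simp: S_def tcoords_def)
qed

text \<open>Carries compact coordinate sets back to the bundle, where
  \<open>one_step_method_order\<close> expects them.\<close>

lemma compactin_tangent_chart:
  assumes "compact C" "C \<subseteq> tcoords A i"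
  shows "compactin (tangent_topology A) {z \<in> tdom A i. tmap A i z \<in> C}"
proof -
  have "compactin (top_of_set (tcoords A i)) C"
    using assms by (simp add: compactin_subtopology)
  then have "compactin (tangent_topology A) (inv_into (tdom A i) (tmap A i) ` C)"
    by (rule image_compactin[OF _ continuous_map_inv_tmap])
  moreover have "inv_into (tdom A i) (tmap A i) ` C = {z \<in> tdom A i. tmap A i z \<in> C}"
  proof (intro equalityI subsetI)
    fix z assume "z \<in> inv_into (tdom A i) (tmap A i) ` C"
    then obtain u where u: "u \<in> C" "z = inv_into (tdom A i) (tmap A i) u" by blast
    then have "u \<in> tmap A i ` tdom A i" using assms tmap_image by auto
    then show "z \<in> {z \<in> tdom A i. tmap A i z \<in> C}"
      using u by (auto intro: inv_into_into simp: f_inv_into_f)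
  next
    fix z assume "z \<in> {z \<in> tdom A i. tmap A i z \<in> C}"
    then show "z \<in> inv_into (tdom A i) (tmap A i) ` C"
      by (auto simp: inv_into_f_f[OF inj_on_tmap] intro!: rev_image_eqI)
  qed
  ultimately show ?thesis by simp
qed

lemma compact_tmap_image:
  assumes "compactin (tangent_topology A) K" "K \<subseteq> tdom A i"
  shows "compact (tmap A i ` K)"
proof -
  have "compactin (subtopology (tangent_topology A) (tdom A i)) K"
    using assms by (simp add: compactin_subtopology)
  from image_compactin[OF this continuous_map_tmap] show ?thesis by simp
qed

text \<open>Compact sets of the Hausdorff manifold are closed, so this is a closed part of a compact
  set. For \<open>N\<close> inside a chart domain it confines initial data to one chart.\<close>

lemma compactin_tangent_over_compact:
  assumes "compactin (tangent_topology A) K" "compact N"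
  shows "compactin (tangent_topology A) {z \<in> K. fst z \<in> N}"
proof -
  have "closedin (tangent_topology A) {z \<in> topspace (tangent_topology A). fst z \<in> N}"
    using closedin_continuous_map_preimage[OF continuous_map_tangent_projection, of N] compact_imp_closed[OF assms(2)]
    by simp
  from closed_Int_compactin[OF this assms(1)]
  have "compactin (tangent_topology A) ({z \<in> topspace (tangent_topology A). fst z \<in> N} \<inter> K)" .
  moreover have "{z \<in> topspace (tangent_topology A). fst z \<in> N} \<inter> K = {z \<in> K. fst z \<in> N}"
    using compactin_subset_topspace[OF assms(1)] by blast
  ultimately show ?thesis by simp
qed

lemma chart_compact_neighbourhood:
  "\<exists>i W N. open W \<and> x \<in> W \<and> W \<subseteq> N \<and> compact N \<and> N \<subseteq> cdom A i"
proof -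
  obtain i where i: "x \<in> cdom A i" using chart_covers by blast
  obtain r where r: "r > 0" "cball (cmap A i x) r \<subseteq> cmap A i ` cdom A i"
    using open_contains_cball[THEN iffD1, OF open_cimage, of i] i by blast
  define W where "W = cdom A i \<inter> cmap A i -` ball (cmap A i x) r"
  define N where "N = cinv A i ` cball (cmap A i x) r"
  have "open W"
    unfolding W_def by (intro continuous_open_preimage continuous_on_cmap open_cdom open_ball)
  moreover have "W \<subseteq> N"
  proof
    fix y assume "y \<in> W"
    then have "cmap A i y \<in> cball (cmap A i x) r" "y = cinv A i (cmap A i y)"
      by (auto simp: W_def cinv_cmap)
    then show "y \<in> N" unfolding N_def by blast
  qed
  moreover have "compact N"
    unfolding N_def by (intro compact_continuous_image continuous_on_subset[OF continuous_on_cinv r(2)] compact_cball)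
  moreover have "N \<subseteq> cdom A i" using r(2) cinv_in_cdom by (auto simp: N_def)
  moreover have "x \<in> W" using i r(1) by (simp add: W_def)
  ultimately have "open W \<and> x \<in> W \<and> W \<subseteq> N \<and> compact N \<and> N \<subseteq> cdom A i" by iprover
  then show ?thesis by (rule exI[of _ i, OF exI[of _ W, OF exI[of _ N]]])
qed

section \<open>Solutions of the Euler--Lagrange equation in charts\<close>

text \<open>Bridges \<open>EL_solution\<close>, whose derivatives are taken within the times spent
  in a chart, and \<open>tangent_lift\<close>, whose derivatives are taken within [0,T].\<close>

lemma at_within_chart_times:
  assumes "continuous_on {0..T} x" "t \<in> {0..T}" "open W" "x t \<in> W"
  shows "at t within {s \<in> {0..T}. x s \<in> W} = at t within {0..T}"
proof -
  obtain V where V: "open V" "V \<inter> {0..T} = x -` W \<inter> {0..T}"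
    using assms(1,3) unfolding continuous_on_open_invariant by blast
  have VW: "s \<in> V \<longleftrightarrow> x s \<in> W" if "s \<in> {0..T}" for s
    using V(2) that by blast
  have "{s \<in> {0..T}. x s \<in> W} \<inter> V = {0..T} \<inter> V"
    using VW by blast
  then show ?thesis
    using at_within_nhd[of t V] V(1) VW[OF assms(2)] assms(4) by metis
qed

lemma EL_solution_chart_derivative:
  assumes sol: "EL_solution A L T x" and t: "t \<in> {0..T}" "x t \<in> cdom A i"
  shows "((cmap A i \<circ> x) has_vector_derivative vector_derivative (cmap A i \<circ> x) (at t within {0..T}))
      (at t within {0..T})"
proof -
  have "(cmap A i \<circ> x) differentiable (at t within {t \<in> {0..T}. x t \<in> cdom A i})"
    using sol t unfolding EL_solution_def euler_lagrange_def Let_def by blast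
  then show ?thesis
    using at_within_chart_times[where W = "cdom A i" and x = x, OF _ t(1) open_cdom t(2)] sol
    by (simp add: EL_solution_def vector_derivative_works)
qed

lemma tangent_lift_in_bundle:
  assumes sol: "EL_solution A L T x" and T: "0 < T" and t: "t \<in> {0..T}"
  shows "tangent_lift A T x t \<in> tangent_bundle A"
proof -
  have eq: "vector_derivative (cmap A j \<circ> x) (at t within {0..T})
      = transition_deriv i j (x t) (vector_derivative (cmap A i \<circ> x) (at t within {0..T}))"
    if i: "x t \<in> cdom A i" and j: "x t \<in> cdom A j" for i j
  proof -
    define J where "J = {s \<in> {0..T}. x s \<in> cdom A i \<inter> cdom A j}"
    define v where "v = vector_derivative (cmap A i \<circ> x) (at t within {0..T})"
    have J: "at t within J = at t within {0..T}"
      unfolding J_def using sol t i j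
      by (intro at_within_chart_times open_Int open_cdom) (auto simp: EL_solution_def)
    have "((cmap A i \<circ> x) has_vector_derivative v) (at t within J)"
      using EL_solution_chart_derivative[OF sol t i] by (simp add: J v_def)
    then have "((cmap A i \<circ> x) has_derivative (\<lambda>s. s *\<^sub>R v)) (at t within J)"
      by (simp add: has_vector_derivative_def)
    moreover have "(cmap A j \<circ> cinv A i has_derivative transition_deriv i j (x t)) (at ((cmap A i \<circ> x) t))"
      using transition_has_derivative[OF i j] by simp
    ultimately have "((cmap A j \<circ> cinv A i) \<circ> (cmap A i \<circ> x) has_derivative
        transition_deriv i j (x t) \<circ> (\<lambda>s. s *\<^sub>R v)) (at t within J)"
      by (rule diff_chain_within[OF _ has_derivative_at_withinI])
    then have "(cmap A j \<circ> x has_derivative transition_deriv i j (x t) \<circ> (\<lambda>s. s *\<^sub>R v)) (at t within J)"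
      by (rule has_derivative_transform[rotated 2]) (use t i j in \<open>auto simp: J_def cinv_cmap\<close>)
    moreover have "transition_deriv i j (x t) \<circ> (\<lambda>s. s *\<^sub>R v) = (\<lambda>s. s *\<^sub>R transition_deriv i j (x t) v)"
      using linear_scale[OF has_derivative_linear[OF transition_has_derivative[OF i j]]] by auto
    ultimately have "(cmap A j \<circ> x has_vector_derivative transition_deriv i j (x t) v) (at t within {0..T})"
      by (simp add: has_vector_derivative_def J)
    \<comment> \<open>The one-sided derivative is unique because the interval is
      nondegenerate.\<close>
    then show ?thesis
      unfolding v_def using vector_derivative_within_cbox[of 0 T t] T t by simp
  qed
  show ?thesis
    unfolding tangent_bundle_def tangent_lift_def mem_Collect_eq case_prod_conv
  proof (intro conjI allI impI)
    fix i j assume "x t \<in> cdom A i \<inter> cdom A j"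
    then have "x t \<in> cdom A i" "x t \<in> cdom A j" by auto
    then show "(if x t \<in> cdom A j then vector_derivative (cmap A j \<circ> x) (at t within {0..T}) else 0) =
        transition_deriv i j (x t) (if x t \<in> cdom A i then vector_derivative (cmap A i \<circ> x) (at t within {0..T}) else 0)"
      using eq[of i j] by (simp only: if_True)
  qed simp
qed

lemma tangent_lift_in_tdom:
  assumes "EL_solution A L T x" "0 < T" "t \<in> {0..T}" "x t \<in> cdom A i"
  shows "tangent_lift A T x t \<in> tdom A i"
  using tangent_lift_in_bundle[OF assms(1-3)] assms(4) by (simp add: tdom_def tangent_lift_def)

lemma tmap_tangent_lift:
  "x t \<in> cdom A i \<Longrightarrow>
    tmap A i (tangent_lift A T x t) = (cmap A i (x t), vector_derivative (cmap A i \<circ> x) (at t within {0..T}))"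
  by (simp add: tmap_def tangent_lift_def)

lemma continuous_on_tmap_tangent_lift:
  assumes sol: "EL_solution A L T x"
  shows "continuous_on {t \<in> {0..T}. x t \<in> cdom A i} (\<lambda>t. tmap A i (tangent_lift A T x t))"
proof -
  let ?J = "{t \<in> {0..T}. x t \<in> cdom A i}"
  have x: "continuous_on {0..T} x" using sol by (simp add: EL_solution_def)
  have "continuous_on ?J (\<lambda>t. vector_derivative (cmap A i \<circ> x) (at t within ?J))"
    using sol unfolding EL_solution_def euler_lagrange_def Let_def by blast
  then have "continuous_on ?J (\<lambda>t. vector_derivative (cmap A i \<circ> x) (at t within {0..T}))"
    by (rule continuous_on_eq) (use at_within_chart_times[where W = "cdom A i" and x = x, OF x _ open_cdom] in auto)
  moreover have "continuous_on ?J (\<lambda>t. cmap A i (x t))"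
    by (rule continuous_on_compose2[OF continuous_on_cmap]) (auto intro: continuous_on_subset[OF x])
  ultimately have "continuous_on ?J (\<lambda>t. (cmap A i (x t), vector_derivative (cmap A i \<circ> x) (at t within {0..T})))"
    by (rule continuous_on_Pair[rotated])
  then show ?thesis
    by (rule continuous_on_eq) (auto simp: tmap_tangent_lift)
qed

text \<open>The times spent in a chart need not form an interval, whereas
  \<open>EL_acceleration\<close> speaks of intervals. Derivatives on a nondegenerate interval are
  unique, so at times in [0,s] those within the chart times, within [0,s] and within [0,T]
  coincide.\<close>

lemma EL_solution_second_order:
  assumes F: "EL_acceleration A L i F"
    and sol: "EL_solution A L T x" and s: "0 < s" "s \<le> T" and dom: "x ` {0..s} \<subseteq> cdom A i"
  defines "X \<equiv> \<lambda>t. tmap A i (tangent_lift A T x t)"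
  assumes t: "t \<in> {0..s}"
  shows "(X has_vector_derivative (snd (X t), F (X t))) (at t within {0..s})"
proof -
  let ?J = "{t \<in> {0..T}. x t \<in> cdom A i}" and ?l = "local_lagrangian A L i"
  define y where "y = cmap A i \<circ> x"
  have J: "{0..s} \<subseteq> ?J" using s dom by auto
  have nb: "at r within {0..s} \<noteq> bot" if "r \<in> {0..s}" for r
    using that s by (simp add: trivial_limit_within islimpt_Icc)
  have EL: "euler_lagrange ?l ?J y"
    using sol unfolding EL_solution_def y_def by blast
  have dy: "(y has_vector_derivative vector_derivative y (at r within ?J)) (at r within {0..s})"
    if r: "r \<in> {0..s}" for r
  proof -
    have "y differentiable (at r within ?J)"
      using EL r J unfolding euler_lagrange_def Let_def by blast
    then show ?thesis
      using has_vector_derivative_within_subset[OF _ J] vector_derivative_works by blast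
  qed
  have vd: "vector_derivative y (at r within {0..s}) = vector_derivative y (at r within ?J)"
    if "r \<in> {0..s}" for r
    using vector_derivative_within[OF nb[OF that] dy[OF that]] .
  have "euler_lagrange ?l {0..s} y"
    unfolding euler_lagrange_def Let_def
  proof (intro conjI allI ballI)
    show "y differentiable (at r within {0..s})" if "r \<in> {0..s}" for r
      using dy[OF that] by (rule differentiableI_vector)
    have "continuous_on ?J (\<lambda>r. vector_derivative y (at r within ?J))"
      using EL unfolding euler_lagrange_def Let_def by blast
    then have "continuous_on {0..s} (\<lambda>r. vector_derivative y (at r within ?J))"
      by (rule continuous_on_subset[OF _ J])
    then show "continuous_on {0..s} (\<lambda>r. vector_derivative y (at r within {0..s}))"
      by (rule continuous_on_eq) (simp add: vd)
    fix w r assume r: "r \<in> {0..s}"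
    have "((\<lambda>s. frechet_derivative ?l (at (y s, vector_derivative y (at s within ?J))) (0, w)) has_real_derivative
        frechet_derivative ?l (at (y r, vector_derivative y (at r within ?J))) (w, 0)) (at r within ?J)"
      using EL r J unfolding euler_lagrange_def Let_def by blast
    then have "((\<lambda>s. frechet_derivative ?l (at (y s, vector_derivative y (at s within ?J))) (0, w)) has_real_derivative
        frechet_derivative ?l (at (y r, vector_derivative y (at r within ?J))) (w, 0)) (at r within {0..s})"
      by (rule DERIV_subset[OF _ J])
    then have "((\<lambda>q. frechet_derivative ?l (at (y q, vector_derivative y (at q within {0..s}))) (0, w)) has_real_derivative
        frechet_derivative ?l (at (y r, vector_derivative y (at r within ?J))) (w, 0)) (at r within {0..s})"
      by (rule has_field_derivative_transform_within[OF _ zero_less_one r]) (simp add: vd)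
    then show "((\<lambda>q. frechet_derivative ?l (at (y q, vector_derivative y (at q within {0..s}))) (0, w)) has_real_derivative
        frechet_derivative ?l (at (y r, vector_derivative y (at r within {0..s}))) (w, 0)) (at r within {0..s})"
      by (simp only: vd[OF r])
  qed
  moreover have "y ` {0..s} \<subseteq> cmap A i ` cdom A i" using dom by (auto simp: y_def)
  ultimately have "second_order_ode F {0..s} y"
    using F s(1) unfolding EL_acceleration_def by blast
  then obtain v where v: "\<And>r. r \<in> {0..s} \<Longrightarrow> (y has_vector_derivative v r) (at r within {0..s})"
      "\<And>r. r \<in> {0..s} \<Longrightarrow> (v has_vector_derivative F (y r, v r)) (at r within {0..s})"
    unfolding second_order_ode_def by blast
  \<comment> \<open>\<open>second_order_ode\<close> only provides some velocity function
    \<open>v\<close>; uniqueness of derivatives identifies it with the velocity in the lift.\<close>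
  have X: "X r = (y r, v r)" if r: "r \<in> {0..s}" for r
  proof -
    have "(y has_vector_derivative vector_derivative y (at r within {0..T})) (at r within {0..T})"
      unfolding y_def using r J by (intro EL_solution_chart_derivative[OF sol]) auto
    then have "(y has_vector_derivative vector_derivative y (at r within {0..T})) (at r within {0..s})"
      by (rule has_vector_derivative_within_subset) (use s in auto)
    then have "vector_derivative y (at r within {0..T}) = v r"
      using v(1)[OF r] vector_derivative_within[OF nb[OF r]] by metis
    moreover have "x r \<in> cdom A i" using r dom by auto
    ultimately show ?thesis by (simp add: X_def tmap_tangent_lift y_def)
  qed
  have "((\<lambda>r. (y r, v r)) has_vector_derivative (v t, F (y t, v t))) (at t within {0..s})"
    by (rule has_vector_derivative_Pair[OF v(1)[OF t] v(2)[OF t]])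
  then have "(X has_vector_derivative (v t, F (y t, v t))) (at t within {0..s})"
    by (rule has_vector_derivative_transform_within[OF _ zero_less_one t]) (simp add: X)
  then show ?thesis by (simp add: X[OF t])
qed

text \<open>There is no first time at which the curve leaves the chart or the open \<open>\<rho>\<close>-ball: up to such a time
  it would stay over a compact, hence (the manifold being Hausdorff) closed subset of the chart.\<close>

lemma EL_solution_stays_in_chart:
  assumes F: "EL_acceleration A L i F"
    and sol: "EL_solution A L T x" and T: "0 < T" "T * V < \<rho>" and \<rho>: "0 < \<rho>"
    and V: "\<forall>u\<in>C. norm (snd u, F u) \<le> V"
    and x0: "x 0 \<in> cdom A i"
  defines "X \<equiv> \<lambda>t. tmap A i (tangent_lift A T x t)"
  assumes C: "cball (X 0) \<rho> \<subseteq> C" "C \<subseteq> tcoords A i"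
    and t: "t \<in> {0..T}"
  shows "x t \<in> cdom A i" "X t \<in> C" "norm (X t - X 0) \<le> V * t"
    "(X has_vector_derivative (snd (X t), F (X t))) (at t within {0..T})"
proof -
  let ?J = "{t \<in> {0..T}. x t \<in> cdom A i}"
  have contx: "continuous_on {0..T} x" using sol by (simp add: EL_solution_def)
  have contX: "continuous_on ?J X" unfolding X_def by (rule continuous_on_tmap_tangent_lift[OF sol])
  define G where "G = ?J \<inter> X -` ball (X 0) \<rho>"
  have "openin (top_of_set {0..T}) ?J"
    using continuous_openin_preimage_gen[OF contx open_cdom[of i]] by (simp add: vimage_def Int_def conj_commute)
  moreover have "openin (top_of_set ?J) G"
    unfolding G_def by (rule continuous_openin_preimage_gen[OF contX open_ball])
  ultimately have openG: "openin (top_of_set {0..T}) G" by (rule openin_trans[rotated])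
  \<comment> \<open>As long as all times so far are in \<open>G\<close>, the state has remained in
    \<open>C\<close>, where its speed is at most \<open>V\<close>.\<close>
  have chain: "norm (X r - X 0) \<le> V * r \<and> (X has_vector_derivative (snd (X r), F (X r))) (at r within {0..s})"
    if s: "0 < s" "s \<le> T" "{0..s} \<subseteq> G" and r: "r \<in> {0..s}" for s r
  proof -
    have dom: "x ` {0..s} \<subseteq> cdom A i" using s by (auto simp: G_def)
    have XC: "X q \<in> C" if "q \<in> {0..s}" for q
      using that s C(1) by (force simp: G_def)
    have der: "(X has_vector_derivative (snd (X q), F (X q))) (at q within {0..s})" if "q \<in> {0..s}" for q
      unfolding X_def by (rule EL_solution_second_order[OF F sol s(1,2) dom that])
    have "norm (X r - X 0) \<le> V * \<bar>r - 0\<bar>"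
      using s r by (intro norm_vector_derivative_bound[of 0 s X "\<lambda>q. (snd (X q), F (X q))"] der V[rule_format] XC) auto
    then show ?thesis using der[OF r] r by simp
  qed
  have "X 0 \<in> C" using C(1) centre_in_cball[of "X 0" \<rho>] \<rho> by auto
  then have V0: "V \<ge> 0" using V norm_ge_zero order_trans by blast
  have "0 \<in> G" using T \<rho> x0 by (simp add: G_def)
  have G: "{0..T} \<subseteq> G"
  proof (rule ccontr)
    assume "\<not> {0..T} \<subseteq> G"
    then have ne: "{0..T} - G \<noteq> {}" by blast
    have "closedin (top_of_set {0..T}) ({0..T} - G)"
      using closedin_diff[OF closedin_topspace openG] by simp
    then have "compact ({0..T} - G)"
      using closedin_compact[OF compact_Icc] by blast
    then obtain \<tau> where \<tau>: "\<tau> \<in> {0..T} - G" "\<And>s. s \<in> {0..T} - G \<Longrightarrow> \<tau> \<le> s"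
      using compact_attains_inf[OF _ ne] by blast
    have "\<tau> > 0" using \<tau>(1) \<open>0 \<in> G\<close> by (cases "\<tau> = 0") auto
    \<comment> \<open>The strict inequality T * V < \<rho> leaves a gap: before
      \<open>\<tau>\<close> the state is in the closed ball of radius V * T, a condition that
      survives the limit and still implies membership in the open \<rho>-ball.\<close>
    have before: "s \<in> G" "norm (X s - X 0) \<le> V * T" if s: "s \<in> {0..<\<tau>}" for s
    proof -
      have sub: "{0..s} \<subseteq> G" using \<tau> s by force
      then show "s \<in> G" using s by auto
      show "norm (X s - X 0) \<le> V * T"
      proof (cases "s = 0")
        case True
        then show ?thesis using V0 T by simp
      next
        case False
        then have "norm (X s - X 0) \<le> V * s" using chain[of s s] sub s \<tau>(1) by auto
        also have "\<dots> \<le> V * T" using s \<tau>(1) V0 by (intro mult_left_mono) auto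
        finally show ?thesis .
      qed
    qed
    have cl: "closure {0..<\<tau>} = {0..\<tau>}" using \<open>\<tau> > 0\<close> by simp
    \<comment> \<open>The coordinates of \<open>x \<tau>\<close> mean nothing until
      \<open>\<tau>\<close> is known to be a time in the chart, so this is settled first, in the
      manifold itself.\<close>
    define N where "N = cinv A i ` fst ` cball (X 0) (V * T)"
    have sub: "fst ` cball (X 0) (V * T) \<subseteq> cmap A i ` cdom A i"
    proof -
      have "cball (X 0) (V * T) \<subseteq> cball (X 0) \<rho>" using T by (intro subset_cball) (simp add: mult.commute)
      then have "cball (X 0) (V * T) \<subseteq> tcoords A i" using C by blast
      then show ?thesis by (auto simp: tcoords_def)
    qed
    have "compact N"
      unfolding N_def
      by (intro compact_continuous_image continuous_on_subset[OF continuous_on_cinv sub] continuous_intros compact_cball)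
    moreover have "x ` {0..<\<tau>} \<subseteq> N"
    proof
      fix y assume "y \<in> x ` {0..<\<tau>}"
      then obtain s where s: "s \<in> {0..<\<tau>}" "y = x s" by blast
      have "x s \<in> cdom A i" using before(1)[OF s(1)] by (simp add: G_def)
      then have "y = cinv A i (fst (X s))" by (simp add: X_def tmap_tangent_lift cinv_cmap s)
      moreover have "X s \<in> cball (X 0) (V * T)"
        using before(2)[OF s(1)] by (simp add: dist_norm norm_minus_commute)
      ultimately show "y \<in> N" unfolding N_def by blast
    qed
    ultimately have "x ` closure {0..<\<tau>} \<subseteq> N"
      using \<tau>(1) by (intro image_closure_subset compact_imp_closed continuous_on_subset[OF contx]) (auto simp: cl)
    moreover have "N \<subseteq> cdom A i" using sub cinv_in_cdom unfolding N_def by blast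
    ultimately have dom: "{0..\<tau>} \<subseteq> ?J" using \<tau>(1) unfolding cl by auto
    have "continuous_on (closure {0..<\<tau>}) X"
      unfolding cl by (rule continuous_on_subset[OF contX dom])
    then have "X ` closure {0..<\<tau>} \<subseteq> cball (X 0) (V * T)"
      by (rule image_closure_subset) (use before(2) in \<open>auto simp: dist_norm norm_minus_commute\<close>)
    moreover have "\<tau> \<in> closure {0..<\<tau>}" using \<open>\<tau> > 0\<close> by (simp add: cl)
    ultimately have "X \<tau> \<in> cball (X 0) (V * T)" by blast
    moreover have "\<tau> \<in> ?J" using \<open>\<tau> > 0\<close> by (intro subsetD[OF dom]) simp
    ultimately have "\<tau> \<in> G" using T by (simp add: G_def mult.commute)
    then show False using \<tau>(1) by blast
  qed
  have "t \<in> G" using G t by blast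
  then show "x t \<in> cdom A i" by (simp add: G_def)
  have "X t \<in> cball (X 0) \<rho>" using \<open>t \<in> G\<close> by (simp add: G_def)
  then show "X t \<in> C" using C(1) by blast
  show "norm (X t - X 0) \<le> V * t"
    "(X has_vector_derivative (snd (X t), F (X t))) (at t within {0..T})"
    using chain[OF T(1) order_refl G t] by auto
qed

section \<open>Convergence of the shooting solution\<close>

text \<open>Reduces the convergence of shooting to \<open>two_point_error_recurrence\<close>. The
  set \<open>C\<close> is part of the conclusion because the Lagrangian has a Lipschitz constant
  only on compact sets.\<close>

lemma shooting_error_in_chart:
  assumes F_lip: "lipschitz_on_compacts (tcoords A i) F"
    and F: "EL_acceleration A L i F"
    and order: "one_step_method_order A L \<Psi> p"
    and nodes: "c 0 = 0" "c n = 1" "\<forall>i<n. c i < c (Suc i)"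
    and D: "compact D" "D \<subseteq> tcoords A i"
  shows "\<exists>C K h0. compact C \<and> C \<subseteq> tcoords A i \<and> 0 < h0 \<and>
    (\<forall>h x z j. 0 < h \<and> h \<le> h0 \<and> EL_solution A L h x \<and> x 0 \<in> cdom A i \<and>
       tmap A i (tangent_lift A h x 0) \<in> D \<and> z 0 \<in> tdom A i \<and> tmap A i (z 0) \<in> D \<and>
       shooting_solution A \<Psi> n c (x 0) (x h) h z \<and> j \<le> n \<longrightarrow>
       z j \<in> tdom A i \<and> tmap A i (z j) \<in> C \<and>
       tangent_lift A h x (c j * h) \<in> tdom A i \<and> tmap A i (tangent_lift A h x (c j * h)) \<in> C \<and>
       norm (tmap A i (z j) - tmap A i (tangent_lift A h x (c j * h))) \<le> K * h ^ p)"
proof -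
  have c01: "0 \<le> c j" "c j \<le> 1" if "j \<le> n" for j
    using nodes_in_unit_interval[of c n j] nodes that by (auto simp: less_imp_le)
  obtain r where r: "r > 0" "(\<Union>u\<in>D. ball u r) \<subseteq> tcoords A i"
    using compact_subset_open_imp_ball_epsilon_subset[OF D(1) open_tcoords D(2)] by blast
  \<comment> \<open>Two layers around \<open>D\<close>: the shooting nodes stay in
    \<open>D1\<close>; the exact solution and the flow curves of single steps, which start in
    \<open>D1\<close>, stay in \<open>D2\<close>. As 2 \<rho> = r / 2, \<open>D2\<close> lies within
    the chart coordinates.\<close>
  define \<rho> where "\<rho> = r / 4"
  define D1 where "D1 = (\<Union>u\<in>D. cball u \<rho>)"
  define D2 where "D2 = (\<Union>u\<in>D. cball u (2 * \<rho>))"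
  have \<rho>: "\<rho> > 0" using r by (simp add: \<rho>_def)
  have comp: "compact D1" "compact D2"
    unfolding D1_def D2_def by (intro compact_minkowski_sum_cball D(1))+
  have D2_sub: "D2 \<subseteq> tcoords A i"
  proof -
    have "cball u (2 * \<rho>) \<subseteq> ball u r" for u :: "'a \<times> 'a" using r by (auto simp: \<rho>_def)
    then show ?thesis using r(2) unfolding D2_def by blast
  qed
  have "D1 \<subseteq> D2" unfolding D1_def D2_def using \<rho> by (intro UN_mono order_refl subset_cball) simp
  then have D1_sub: "D1 \<subseteq> tcoords A i" using D2_sub by blast
  have D_D1: "D \<subseteq> D1" unfolding D1_def using \<rho> by force
  have ball_D1: "cball u \<rho> \<subseteq> D2" if u: "u \<in> D1" for u
  proof -
    obtain w where w: "w \<in> D" "dist w u \<le> \<rho>" using u unfolding D1_def by auto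
    have "cball u \<rho> \<subseteq> cball w (2 * \<rho>)"
    proof
      fix v assume "v \<in> cball u \<rho>"
      then show "v \<in> cball w (2 * \<rho>)" using w(2) dist_triangle[of w v u] by simp
    qed
    then show ?thesis using w(1) unfolding D2_def by blast
  qed
  obtain M where M: "M-lipschitz_on D2 F"
    using F_lip comp D2_sub unfolding lipschitz_on_compacts_def by blast
  have M0: "M \<ge> 0" using M by (rule lipschitz_on_nonneg)
  have "compact ((\<lambda>u. (snd u, F u)) ` D2)"
    by (intro compact_continuous_image comp continuous_intros lipschitz_on_continuous_on[OF M])
  then obtain V where V: "V > 0" "\<forall>u\<in>D2. norm (snd u, F u) \<le> V"
    using compact_imp_bounded[THEN bounded_normE] by (metis (mono_tags, lifting) imageI)
  obtain C0 h0 where h0: "h0 > 0" and C0: "\<And>z h. z \<in> tdom A i \<Longrightarrow> tmap A i z \<in> D1 \<Longrightarrow> 0 < h \<Longrightarrow> h \<le> h0 \<Longrightarrow>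
       \<exists>w. EL_flow A L h z w \<and> w \<in> tdom A i \<and> \<Psi> h z \<in> tdom A i \<and>
           norm (tmap A i (\<Psi> h z) - tmap A i w) \<le> C0 * h ^ (p + 1)"
  proof -
    have "{z \<in> tdom A i. tmap A i z \<in> D1} \<subseteq> tdom A i" by blast
    moreover have "compactin (tangent_topology A) {z \<in> tdom A i. tmap A i z \<in> D1}"
      by (rule compactin_tangent_chart[OF comp(1) D1_sub])
    ultimately have "\<exists>C. \<exists>h0>0. \<forall>z\<in>{z \<in> tdom A i. tmap A i z \<in> D1}. \<forall>h. 0 < h \<and> h \<le> h0 \<longrightarrow>
           (\<exists>w. EL_flow A L h z w \<and> w \<in> tdom A i \<and> \<Psi> h z \<in> tdom A i \<and>
                norm (tmap A i (\<Psi> h z) - tmap A i w) \<le> C * h ^ (p + 1))"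
      using order unfolding one_step_method_order_def by blast
    then show ?thesis using that by blast
  qed
  define C1 where "C1 = \<bar>C0\<bar>"
  have C1: "C1 \<ge> 0" by (simp add: C1_def)
  \<comment> \<open>The four bounds serve, in this order, the estimate s^(p+1) \<le> s, the validity
    of the local error bound, the comparison of flow curves, and confinement to the layers.\<close>
  define h1 where "h1 = min (min 1 h0) (min (1 / (2 * (1 + M))) (\<rho> / (2 * (V + C1))))"
  have h1: "h1 > 0" using h0 M0 \<rho> V C1 by (auto simp: h1_def intro!: divide_pos_pos add_pos_nonneg)
  have small: "s \<le> 1" "s \<le> h0" "s * (1 + M) \<le> 1 / 2" "(V + C1) * s < \<rho>" "s * V < \<rho>"
    if s: "0 < s" "s \<le> h1" for s
  proof -
    show "s \<le> 1" "s \<le> h0" using s by (auto simp: h1_def)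
    have "s \<le> 1 / (2 * (1 + M))" using s by (auto simp: h1_def)
    then show "s * (1 + M) \<le> 1 / 2" using M0 by (simp add: field_simps)
    have "s \<le> \<rho> / (2 * (V + C1))" using s by (auto simp: h1_def)
    then have "2 * ((V + C1) * s) \<le> \<rho>" using V(1) C1 by (simp add: field_simps)
    then show *: "(V + C1) * s < \<rho>" using \<rho> by linarith
    have "0 \<le> C1 * s" using s C1 by simp
    with * show "s * V < \<rho>" by (simp add: algebra_simps)
  qed
  \<comment> \<open>One step of the method shadows a genuine flow curve \<open>Y\<close> from the
    same point. The displacement is at most V s along the flow plus C1 s for the local
    error.\<close>
  have step: "\<exists>Y. Y 0 = tmap A i z \<and>
      (\<forall>t\<in>{0..s}. Y t \<in> D2 \<and> (Y has_vector_derivative (snd (Y t), F (Y t))) (at t within {0..s})) \<and>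
      \<Psi> s z \<in> tdom A i \<and> norm (tmap A i (\<Psi> s z) - Y s) \<le> C1 * s ^ (p + 1) \<and>
      norm (tmap A i (\<Psi> s z) - tmap A i z) \<le> (V + C1) * s"
    if z: "z \<in> tdom A i" "tmap A i z \<in> D1" and s: "0 < s" "s \<le> h1" for z s
  proof -
    obtain w where w: "EL_flow A L s z w" "w \<in> tdom A i" "\<Psi> s z \<in> tdom A i"
      "norm (tmap A i (\<Psi> s z) - tmap A i w) \<le> C0 * s ^ (p + 1)"
      using C0[OF z s(1) small(2)[OF s]] by blast
    obtain y where y: "EL_solution A L s y" "tangent_lift A s y 0 = z" "tangent_lift A s y s = w"
      using w(1) unfolding EL_flow_def by blast
    define Y where "Y t = tmap A i (tangent_lift A s y t)" for t
    have "fst z = y 0" using y(2) by (auto simp: tangent_lift_def)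
    then have y0: "y 0 \<in> cdom A i" using z by (simp add: tdom_def)
    have "cball (Y 0) \<rho> \<subseteq> D2" using ball_D1[OF z(2)] by (simp add: Y_def y)
    note stay = EL_solution_stays_in_chart[OF F y(1) s(1) small(5)[OF s] \<rho> V(2) y0 this[unfolded Y_def] D2_sub,
        folded Y_def]
    have err: "norm (tmap A i (\<Psi> s z) - Y s) \<le> C1 * s ^ (p + 1)"
    proof -
      have "C0 * s ^ (p + 1) \<le> C1 * s ^ (p + 1)"
        using s(1) by (intro mult_right_mono) (auto simp: C1_def)
      then show ?thesis using w(4) unfolding Y_def y(3) by linarith
    qed
    have "s ^ (p + 1) \<le> s"
      using s small(1)[OF s] by (simp add: mult_left_le power_le_one)
    then have "C1 * s ^ (p + 1) \<le> C1 * s" using C1 by (rule mult_left_mono)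
    then have "norm (tmap A i (\<Psi> s z) - Y s) \<le> C1 * s" using err by linarith
    moreover have "norm (Y s - Y 0) \<le> V * s" using stay(3)[of s] s by simp
    ultimately have "norm (tmap A i (\<Psi> s z) - Y 0) \<le> (V + C1) * s"
      using norm_triangle_ineq[of "tmap A i (\<Psi> s z) - Y s" "Y s - Y 0"] by (simp add: algebra_simps)
    moreover have "Y 0 = tmap A i z" by (simp add: Y_def y)
    ultimately show ?thesis
      using stay(2,4) err w(3) by (intro exI[of _ Y]) auto
  qed
  \<comment> \<open>2 M stems from the comparison of flow curves, \<open>C1\<close> from the local
    error of the method.\<close>
  define K where "K = 2 * M + C1"
  have "K \<ge> 0" using M0 C1 by (simp add: K_def)
  then obtain K' h2 where h2: "h2 > 0" and K': "\<And>(e :: nat \<Rightarrow> 'a \<times> 'a) h j.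
     0 < h \<Longrightarrow> h \<le> h2 \<Longrightarrow> fst (e 0) = 0 \<Longrightarrow> fst (e n) = 0 \<Longrightarrow>
     (\<And>j. j < n \<Longrightarrow> norm (snd (e (Suc j)) - snd (e j)) \<le> K * (h * norm (e j) + h ^ (p + 1)) \<and>
            norm (fst (e (Suc j)) - fst (e j) - ((c (Suc j) - c j) * h) *\<^sub>R snd (e j))
              \<le> K * (h\<^sup>2 * norm (e j) + h ^ (p + 1))) \<Longrightarrow> j \<le> n \<Longrightarrow> norm (e j) \<le> K' * h ^ p"
    using two_point_error_recurrence[OF nodes(1,2) less_imp_le[OF nodes(3)[rule_format]], of K p, where 'a = 'a] by blast
  have main: "z j \<in> tdom A i \<and> tmap A i (z j) \<in> D2 \<and>
       tangent_lift A h x (c j * h) \<in> tdom A i \<and> tmap A i (tangent_lift A h x (c j * h)) \<in> D2 \<and>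
       norm (tmap A i (z j) - tmap A i (tangent_lift A h x (c j * h))) \<le> K' * h ^ p"
    if h: "0 < h" "h \<le> h1" "h \<le> h2" and x: "EL_solution A L h x" "x 0 \<in> cdom A i"
      "tmap A i (tangent_lift A h x 0) \<in> D" and z0: "z 0 \<in> tdom A i" "tmap A i (z 0) \<in> D"
      and sh: "shooting_solution A \<Psi> n c (x 0) (x h) h z" and j: "j \<le> n" for h x z j
  proof -
    define X where "X t = tmap A i (tangent_lift A h x t)" for t
    have "X 0 \<in> D1" using x(3) D_D1 by (auto simp: X_def)
    from ball_D1[OF this] have "cball (X 0) \<rho> \<subseteq> D2" .
    note stay = EL_solution_stays_in_chart[OF F x(1) h(1) small(5)[OF h(1,2)] \<rho> V(2) x(2) this[unfolded X_def] D2_sub,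
        folded X_def]
    define s where "s j = (c (Suc j) - c j) * h" for j
    have s: "0 < s j" "s j \<le> h" "s j \<le> h1" if "j < n" for j
    proof -
      show "0 < s j" using nodes(3)[rule_format, OF that] h by (simp add: s_def)
      show *: "s j \<le> h" using c01[of j] c01[of "Suc j"] that h by (auto simp: s_def intro!: mult_left_le_one_le)
      show "s j \<le> h1" using * h by linarith
    qed
    have ch: "c j * h \<in> {0..h}" if "j \<le> n" for j
      using c01[OF that] h by (auto intro: mult_left_le_one_le)
    have zstep: "z (Suc j) = \<Psi> (s j) (z j)" if "j < n" for j
      using sh that by (simp add: shooting_solution_def s_def)
    \<comment> \<open>Step lengths telescope, so the displacement up to node \<open>j\<close> is at
      most (V + C1) c_j h < \<rho>. This keeps the node in \<open>D1\<close> and so permits the next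
      application of \<open>step\<close>.\<close>
    have near: "z j \<in> tdom A i \<and> norm (tmap A i (z j) - tmap A i (z 0)) \<le> (V + C1) * (c j * h)" if "j \<le> n" for j
      using that
    proof (induction j)
      case 0
      then show ?case using z0 nodes by simp
    next
      case (Suc j)
      then have IH: "z j \<in> tdom A i" "norm (tmap A i (z j) - tmap A i (z 0)) \<le> (V + C1) * (c j * h)"
        by auto
      have "(V + C1) * (c j * h) \<le> (V + C1) * h"
        using ch[of j] Suc.prems V(1) C1 by (intro mult_left_mono) auto
      then have "tmap A i (z j) \<in> cball (tmap A i (z 0)) \<rho>"
        using IH(2) small(4)[OF h(1,2)] by (simp add: dist_norm norm_minus_commute)
      then have "tmap A i (z j) \<in> D1" using z0(2) unfolding D1_def by blast
      from step[OF IH(1) this s(1,3)[of j]] Suc.prems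
      have "\<Psi> (s j) (z j) \<in> tdom A i" "norm (tmap A i (\<Psi> (s j) (z j)) - tmap A i (z j)) \<le> (V + C1) * s j"
        by auto
      then have "z (Suc j) \<in> tdom A i" "norm (tmap A i (z (Suc j)) - tmap A i (z j)) \<le> (V + C1) * s j"
        using zstep[of j] Suc.prems by auto
      moreover have "(V + C1) * s j + (V + C1) * (c j * h) = (V + C1) * (c (Suc j) * h)"
        by (simp add: s_def algebra_simps)
      ultimately show ?case
        using IH(2) norm_triangle_ineq[of "tmap A i (z (Suc j)) - tmap A i (z j)" "tmap A i (z j) - tmap A i (z 0)"]
        by simp
    qed
    have zD1: "tmap A i (z j) \<in> D1" if "j \<le> n" for j
    proof -
      have "(V + C1) * (c j * h) \<le> (V + C1) * h"
        using ch[OF that] V(1) C1 by (intro mult_left_mono) auto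
      then have "tmap A i (z j) \<in> cball (tmap A i (z 0)) \<rho>"
        using near[OF that] small(4)[OF h(1,2)] by (simp add: dist_norm norm_minus_commute)
      then show ?thesis using z0(2) unfolding D1_def by blast
    qed
    define e where "e j = tmap A i (z j) - X (c j * h)" for j
    have fstX: "fst (X t) = cmap A i (x t)" for t
      by (simp add: X_def tmap_def tangent_lift_def)
    have "norm (e j) \<le> K' * h ^ p"
    proof (rule K'[OF h(1,3) _ _ _ j])
      show "fst (e 0) = 0" "fst (e n) = 0"
        using sh nodes by (auto simp: e_def fstX shooting_solution_def) (auto simp: tmap_def)
      fix j assume j: "j < n"
      then obtain Y where Y: "Y 0 = tmap A i (z j)"
        "\<forall>t\<in>{0..s j}. Y t \<in> D2 \<and> (Y has_vector_derivative (snd (Y t), F (Y t))) (at t within {0..s j})"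
        "norm (tmap A i (\<Psi> (s j) (z j)) - Y (s j)) \<le> C1 * s j ^ (p + 1)"
        using step[OF _ zD1 s(1,3)] near[of j] by (metis less_imp_le)
      \<comment> \<open>The exact solution restarted at node \<open>j\<close>, so that it can be
        compared with \<open>Y\<close> from time 0 on.\<close>
      define X' where "X' t = X (c j * h + t)" for t
      have X': "\<forall>t\<in>{0..s j}. X' t \<in> D2 \<and> (X' has_vector_derivative (snd (X' t), F (X' t))) (at t within {0..s j})"
      proof
        fix t assume t: "t \<in> {0..s j}"
        have sub: "(\<lambda>t. c j * h + t) ` {0..s j} \<subseteq> {0..h}"
          using ch[of j] ch[of "Suc j"] j by (auto simp: s_def algebra_simps)
        then have t': "c j * h + t \<in> {0..h}" using t by blast
        have "((\<lambda>t. c j * h + t) has_vector_derivative 1) (at t within {0..s j})"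
          by (auto intro!: derivative_eq_intros)
        then have "(X \<circ> (\<lambda>t. c j * h + t) has_vector_derivative 1 *\<^sub>R (snd (X' t), F (X' t))) (at t within {0..s j})"
          using stay(4)[OF t'] unfolding X'_def
          by (intro vector_diff_chain_within has_vector_derivative_within_subset[OF _ sub])
        then show "X' t \<in> D2 \<and> (X' has_vector_derivative (snd (X' t), F (X' t))) (at t within {0..s j})"
          using stay(2)[OF t'] by (simp add: X'_def[abs_def] comp_def)
      qed
      note cmp = second_order_ode_comparison[of "s j" Y D2 F X' M, OF Y(2) X' M less_imp_le[OF s(1)[OF j]]
          small(3)[OF s(1)[OF j] s(3)[OF j]]]
      define g where "g = tmap A i (z (Suc j)) - Y (s j)"
      have g: "norm g \<le> C1 * h ^ (p + 1)"
      proof -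
        have "s j ^ (p + 1) \<le> h ^ (p + 1)" using s[OF j] by (intro power_mono) auto
        then have "C1 * s j ^ (p + 1) \<le> C1 * h ^ (p + 1)" using C1 by (intro mult_left_mono)
        then show ?thesis using Y(3) zstep[OF j] by (simp add: g_def)
      qed
      have d0: "Y 0 - X' 0 = e j" by (simp add: Y e_def X'_def)
      \<comment> \<open>The new error splits into the old one propagated by the exact flow and the
        local error \<open>g\<close>.\<close>
      have ds: "Y (s j) - X' (s j) = e (Suc j) - g"
        by (simp add: e_def X'_def g_def s_def algebra_simps)
      have "norm (snd (e (Suc j)) - snd (e j)) \<le> norm (snd (e (Suc j) - g) - snd (e j)) + norm (snd g)"
        using norm_triangle_ineq[of "snd (e (Suc j) - g) - snd (e j)" "snd g"] by (simp add: algebra_simps)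
      also have "\<dots> \<le> 2 * M * s j * norm (e j) + C1 * h ^ (p + 1)"
        using cmp(2) g norm_snd_le[of "snd g" "fst g"] unfolding d0 ds by simp
      also have "\<dots> \<le> K * (h * norm (e j)) + K * h ^ (p + 1)"
      proof (rule add_mono)
        have "(2 * M) * (s j * norm (e j)) \<le> K * (h * norm (e j))"
          using s[OF j] M0 C1 by (intro mult_mono mult_right_mono) (auto simp: K_def)
        then show "2 * M * s j * norm (e j) \<le> K * (h * norm (e j))" by (simp add: mult.assoc)
        show "C1 * h ^ (p + 1) \<le> K * h ^ (p + 1)"
          using M0 h by (intro mult_right_mono) (auto simp: K_def)
      qed
      finally have 1: "norm (snd (e (Suc j)) - snd (e j)) \<le> K * (h * norm (e j) + h ^ (p + 1))"
        by (simp add: distrib_left)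
      have "norm (fst (e (Suc j)) - fst (e j) - s j *\<^sub>R snd (e j))
          \<le> norm (fst (e (Suc j) - g) - fst (e j) - s j *\<^sub>R snd (e j)) + norm (fst g)"
        using norm_triangle_ineq[of "fst (e (Suc j) - g) - fst (e j) - s j *\<^sub>R snd (e j)" "fst g"]
        by (simp add: algebra_simps)
      also have "\<dots> \<le> 2 * M * (s j)\<^sup>2 * norm (e j) + C1 * h ^ (p + 1)"
        using cmp(3) g norm_fst_le[of "fst g" "snd g"] unfolding d0 ds by simp
      also have "\<dots> \<le> K * (h\<^sup>2 * norm (e j)) + K * h ^ (p + 1)"
      proof (rule add_mono)
        have "(2 * M) * ((s j)\<^sup>2 * norm (e j)) \<le> K * (h\<^sup>2 * norm (e j))"
          using s[OF j] M0 C1 by (intro mult_mono mult_right_mono power_mono) (auto simp: K_def)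
        then show "2 * M * (s j)\<^sup>2 * norm (e j) \<le> K * (h\<^sup>2 * norm (e j))" by (simp add: mult.assoc)
        show "C1 * h ^ (p + 1) \<le> K * h ^ (p + 1)"
          using M0 h by (intro mult_right_mono) (auto simp: K_def)
      qed
      finally have "norm (fst (e (Suc j)) - fst (e j) - ((c (Suc j) - c j) * h) *\<^sub>R snd (e j))
              \<le> K * (h\<^sup>2 * norm (e j) + h ^ (p + 1))"
        by (simp add: distrib_left s_def)
      with 1 show "norm (snd (e (Suc j)) - snd (e j)) \<le> K * (h * norm (e j) + h ^ (p + 1)) \<and>
            norm (fst (e (Suc j)) - fst (e j) - ((c (Suc j) - c j) * h) *\<^sub>R snd (e j))
              \<le> K * (h\<^sup>2 * norm (e j) + h ^ (p + 1))" ..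
    qed
    moreover have "tangent_lift A h x (c j * h) \<in> tdom A i"
      by (rule tangent_lift_in_tdom[OF x(1) h(1) ch[OF j] stay(1)[OF ch[OF j]]])
    ultimately show ?thesis
      using near[OF j] zD1[OF j] \<open>D1 \<subseteq> D2\<close> stay(2)[OF ch[OF j]] by (auto simp: e_def X_def)
  qed
  show ?thesis
    using main comp(2) D2_sub h1 h2
    by (intro exI[of _ D2] exI[of _ K'] exI[of _ "min h1 h2"]) auto
qed

section \<open>From nodal errors to the error of the discrete Lagrangian\<close>

lemma discrete_lagrangian_error_over_chart:
  assumes lipschitz: "lipschitz_lagrangian A L"
    and second_order: "EL_second_order A L"
    and order: "one_step_method_order A L \<Psi> p"
    and nodes: "c 0 = 0" "c n = 1" "\<forall>i<n. c i < c (Suc i)"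
    and quadrature: "quadrature_order n b c q"
    and U: "U \<subseteq> U'" "compactin (tangent_topology A) U'"
    and regularity: "C_k_along_solutions A L U q"
    and shooting: "converged_shooting A L U \<Psi> n c Z"
    and N: "compact N" "N \<subseteq> cdom A i"
  shows "\<exists>C. \<exists>h0>0. \<forall>h x. 0 < h \<and> h \<le> h0 \<and> EL_solution A L h x \<and> tangent_lift A h x 0 \<in> U \<and> x 0 \<in> N \<longrightarrow>
        \<bar>shooting_discrete_lagrangian L n b Z (x 0) (x h) h - exact_discrete_lagrangian A L h x\<bar>
          \<le> C * h ^ (min p q + 1)"
proof -
  obtain F where F_lip: "lipschitz_on_compacts (tcoords A i) F"
    and F: "EL_acceleration A L i F"
    using second_order unfolding EL_second_order_def EL_acceleration_def by metis
  obtain K h1 where K: "compactin (tangent_topology A) K" and h1: "h1 > 0"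
    and Z: "\<And>h x. 0 < h \<Longrightarrow> h \<le> h1 \<Longrightarrow> EL_solution A L h x \<Longrightarrow> tangent_lift A h x 0 \<in> U \<Longrightarrow>
           shooting_solution A \<Psi> n c (x 0) (x h) h (Z (x 0) (x h) h) \<and> Z (x 0) (x h) h 0 \<in> K"
    using shooting unfolding converged_shooting_def by blast
  obtain B h2 where h2: "h2 > 0"
    and B: "\<And>h x. 0 < h \<Longrightarrow> h \<le> h2 \<Longrightarrow> EL_solution A L h x \<Longrightarrow> tangent_lift A h x 0 \<in> U \<Longrightarrow>
        C_k_bounded_by q B {0..h} (\<lambda>t. L (tangent_lift A h x t))"
    using regularity unfolding C_k_along_solutions_def by blast
  \<comment> \<open>Holds the initial data of both curves: the exact ones come from
    \<open>U'\<close>, the shooting ones from \<open>K\<close>, and both lie over the same point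
    \<open>x 0\<close> of \<open>N\<close>. Hence one chart serves both.\<close>
  define S where "S = {z \<in> U' \<union> K. fst z \<in> N}"
  have S: "compactin (tangent_topology A) S"
    unfolding S_def by (intro compactin_tangent_over_compact compactin_Un U K N)
  have S_tdom: "S \<subseteq> tdom A i"
    using compactin_subset_topspace[OF S] N(2) by (auto simp: topspace_tangent_topology tdom_def S_def)
  define D where "D = tmap A i ` S"
  have D: "compact D" "D \<subseteq> tcoords A i"
    unfolding D_def using compact_tmap_image[OF S S_tdom] S_tdom tmap_image by auto
  obtain C J h3 where C: "compact C" "C \<subseteq> tcoords A i" and h3: "h3 > 0"
    and err: "\<And>h x z j. 0 < h \<Longrightarrow> h \<le> h3 \<Longrightarrow> EL_solution A L h x \<Longrightarrow> x 0 \<in> cdom A i \<Longrightarrow>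
       tmap A i (tangent_lift A h x 0) \<in> D \<Longrightarrow> z 0 \<in> tdom A i \<Longrightarrow> tmap A i (z 0) \<in> D \<Longrightarrow>
       shooting_solution A \<Psi> n c (x 0) (x h) h z \<Longrightarrow> j \<le> n \<Longrightarrow>
       z j \<in> tdom A i \<and> tmap A i (z j) \<in> C \<and>
       tangent_lift A h x (c j * h) \<in> tdom A i \<and> tmap A i (tangent_lift A h x (c j * h)) \<in> C \<and>
       norm (tmap A i (z j) - tmap A i (tangent_lift A h x (c j * h))) \<le> J * h ^ p"
    using shooting_error_in_chart[OF F_lip F order nodes D] by (elim exE conjE) blast
  obtain M where M: "M-lipschitz_on C (local_lagrangian A L i)"
    using lipschitz C unfolding lipschitz_lagrangian_def lipschitz_on_compacts_def by blast
  have M0: "M \<ge> 0" using M by (rule lipschitz_on_nonneg)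
  have c01: "c j \<in> {0..1}" if "j \<le> n" for j
    using nodes_in_unit_interval[of c n j] nodes that by (simp add: less_imp_le)
  define W where "W = (\<Sum>j\<le>n. \<bar>b j\<bar>)"
  have W: "W \<ge> 0" unfolding W_def by (intro sum_nonneg) simp
  \<comment> \<open>The first summand collects the nodal errors, passed through the Lipschitz
    constant of the Lagrangian; the second is the quadrature error.\<close>
  define E where "E = W * (M * \<bar>J\<bar>) + \<bar>B\<bar> * (1 + W)"
  have "\<bar>shooting_discrete_lagrangian L n b Z (x 0) (x h) h - exact_discrete_lagrangian A L h x\<bar>
          \<le> E * h ^ (min p q + 1)"
    if h: "0 < h" "h \<le> min (min 1 h1) (min h2 h3)" and x: "EL_solution A L h x" "tangent_lift A h x 0 \<in> U" "x 0 \<in> N"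
    for h x
  proof -
    define z where "z = Z (x 0) (x h) h"
    define l where "l t = L (tangent_lift A h x t)" for t
    have z: "shooting_solution A \<Psi> n c (x 0) (x h) h z" "z 0 \<in> K"
      using Z[OF h(1) _ x(1,2)] h(2) by (auto simp: z_def)
    have zS: "z 0 \<in> S" and xS: "tangent_lift A h x 0 \<in> S"
      using z x U(1) by (auto simp: S_def shooting_solution_def tangent_lift_def)
    have "\<bar>L (z j) - l (c j * h)\<bar> \<le> M * \<bar>J\<bar> * h ^ p" if j: "j \<le> n" for j
    proof -
      have *: "z j \<in> tdom A i" "tmap A i (z j) \<in> C"
        "tangent_lift A h x (c j * h) \<in> tdom A i" "tmap A i (tangent_lift A h x (c j * h)) \<in> C"
        "norm (tmap A i (z j) - tmap A i (tangent_lift A h x (c j * h))) \<le> J * h ^ p"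
        using err[OF h(1) _ x(1) _ _ _ _ z(1) j] h(2) zS xS x(3) N(2) S_tdom by (auto simp: D_def)
      have "\<bar>L (z j) - l (c j * h)\<bar> \<le> M * norm (tmap A i (z j) - tmap A i (tangent_lift A h x (c j * h)))"
        using lipschitz_onD[OF M *(2,4)] *(1,3) by (simp add: local_lagrangian_tmap l_def dist_norm)
      also have "\<dots> \<le> M * (\<bar>J\<bar> * h ^ p)"
        using *(5) M0 h(1) by (intro mult_left_mono order_trans[OF *(5)] mult_right_mono) auto
      finally show ?thesis by (simp add: mult.assoc)
    qed
    then have "\<bar>\<Sum>j\<le>n. b j * (L (z j) - l (c j * h))\<bar> \<le> (\<Sum>j\<le>n. \<bar>b j\<bar> * (M * \<bar>J\<bar> * h ^ p))"
      by (intro order_trans[OF sum_abs] sum_mono) (auto simp: abs_mult intro!: mult_left_mono)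
    also have "\<dots> = W * (M * \<bar>J\<bar>) * h ^ p"
      by (simp add: W_def sum_distrib_left sum_distrib_right mult_ac)
    finally have "\<bar>h * (\<Sum>j\<le>n. b j * (L (z j) - l (c j * h)))\<bar> \<le> W * (M * \<bar>J\<bar>) * h ^ (p + 1)"
      using h(1) by (simp add: abs_mult mult_left_mono mult_ac)
    moreover have "\<bar>integral {0..h} l - h * (\<Sum>j\<le>n. b j * l (c j * h))\<bar> \<le> \<bar>B\<bar> * (1 + W) * h ^ (q + 1)"
    proof -
      have "C_k_bounded_by q B {0..h} l"
        using B[OF h(1) _ x(1,2)] h(2) by (simp add: l_def[abs_def])
      from quadrature_error_bound[OF quadrature c01 _ this]
      have "\<bar>integral {0..h} l - h * (\<Sum>j\<le>n. b j * l (c j * h))\<bar> \<le> B * (1 + W) * h ^ (q + 1)"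
        using h(1) by (simp add: W_def)
      also have "\<dots> \<le> \<bar>B\<bar> * (1 + W) * h ^ (q + 1)"
        using W h(1) by (intro mult_right_mono) auto
      finally show ?thesis .
    qed
    moreover have "shooting_discrete_lagrangian L n b Z (x 0) (x h) h - exact_discrete_lagrangian A L h x
        = h * (\<Sum>j\<le>n. b j * (L (z j) - l (c j * h))) - (integral {0..h} l - h * (\<Sum>j\<le>n. b j * l (c j * h)))"
      by (simp add: shooting_discrete_lagrangian_def exact_discrete_lagrangian_def z_def l_def[abs_def]
          right_diff_distrib sum_subtractf)
    ultimately have "\<bar>shooting_discrete_lagrangian L n b Z (x 0) (x h) h - exact_discrete_lagrangian A L h x\<bar>
        \<le> W * (M * \<bar>J\<bar>) * h ^ (p + 1) + \<bar>B\<bar> * (1 + W) * h ^ (q + 1)"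
      by linarith
    \<comment> \<open>As \<open>h\<close> is at most 1, both exponents may be lowered to the
      minimum.\<close>
    also have "\<dots> \<le> W * (M * \<bar>J\<bar>) * h ^ (min p q + 1) + \<bar>B\<bar> * (1 + W) * h ^ (min p q + 1)"
      using h W M0 by (intro add_mono mult_left_mono power_decreasing) auto
    finally show ?thesis by (simp add: E_def distrib_right)
  qed
  moreover have "min (min 1 h1) (min h2 h3) > 0" using h1 h2 h3 by simp
  ultimately show ?thesis by blast
qed

text \<open>The neighbourhoods \<open>W m\<close> of the points \<open>m\<close> pull back under the
  projection to an open cover of the bundle; the centres of a finite subcover form
  \<open>P\<close>.\<close>

lemma compact_cover_by_chart_compacts:
  assumes "compactin (tangent_topology A) S"
  obtains P :: "'m set" and N I where "finite P" "\<And>m. m \<in> P \<Longrightarrow> compact (N m) \<and> N m \<subseteq> cdom A (I m)"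
    "\<And>z. z \<in> S \<Longrightarrow> \<exists>m\<in>P. fst z \<in> N m"
proof -
  obtain I W N where IWN: "\<And>x. open (W x) \<and> x \<in> W x \<and> W x \<subseteq> N x \<and> compact (N x) \<and> N x \<subseteq> cdom A (I x)"
    using chart_compact_neighbourhood by metis
  define G where "G m = {z \<in> topspace (tangent_topology A). fst z \<in> W m}" for m
  have "openin (tangent_topology A) (G m)" for m
    unfolding G_def using openin_continuous_map_preimage[OF continuous_map_tangent_projection, of "W m"] IWN by simp
  moreover have "S \<subseteq> \<Union> (range G)"
    using compactin_subset_topspace[OF assms] IWN by (auto simp: G_def subset_iff)
  ultimately obtain \<F> where \<F>: "finite \<F>" "\<F> \<subseteq> range G" "S \<subseteq> \<Union> \<F>"
    using assms unfolding compactin_def by (metis (no_types, lifting) imageE)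
  then obtain P where P: "finite P" "\<F> = G ` P" using finite_subset_image by metis
  show thesis
  proof (rule that[OF P(1), of N I])
    show "compact (N m) \<and> N m \<subseteq> cdom A (I m)" for m using IWN by blast
    fix z assume "z \<in> S"
    then obtain m where "m \<in> P" "fst z \<in> W m" using \<F>(3) P(2) by (auto simp: G_def)
    then show "\<exists>m\<in>P. fst z \<in> N m" using IWN by blast
  qed
qed

end

theorem theorem1:
  fixes A :: "('i, 'm::{t2_space,second_countable_topology}, 'a::euclidean_space) atlas"
    and L :: "'m \<times> ('i \<Rightarrow> 'a) \<Rightarrow> real"
    and \<Psi> :: "real \<Rightarrow> 'm \<times> ('i \<Rightarrow> 'a) \<Rightarrow> 'm \<times> ('i \<Rightarrow> 'a)"
    and b c :: "nat \<Rightarrow> real"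
    and n p q :: nat
    and U :: "('m \<times> ('i \<Rightarrow> 'a)) set"
    and Z :: "'m \<Rightarrow> 'm \<Rightarrow> real \<Rightarrow> nat \<Rightarrow> 'm \<times> ('i \<Rightarrow> 'a)"
  assumes atlas: "smooth_atlas A"
    and lipschitz: "lipschitz_lagrangian A L"
    and second_order: "EL_second_order A L"
    and one_step: "\<And>h. h > 0 \<Longrightarrow> \<Psi> h \<in> tangent_bundle A \<rightarrow> tangent_bundle A"
    and one_step_order: "p \<ge> 1" "one_step_method_order A L \<Psi> p"
    and nodes: "c 0 = 0" "c n = 1" "\<And>i. i < n \<Longrightarrow> c i < c (Suc i)"
    and quadrature: "quadrature_order n b c q"
    and initial_data: "openin (tangent_topology A) U"
      "compactin (tangent_topology A) (tangent_topology A closure_of U)"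
    and regularity: "C_k_along_solutions A L U q"
    and shooting: "converged_shooting A L U \<Psi> n c Z"
  shows "discrete_lagrangian_order A L U (shooting_discrete_lagrangian L n b Z) (min p q)"
proof -
  let ?T = "tangent_topology A" and ?r = "min p q"
  define err where "err h x = \<bar>shooting_discrete_lagrangian L n b Z (x 0) (x h) h - exact_discrete_lagrangian A L h x\<bar>"
    for h x
  have U: "U \<subseteq> ?T closure_of U"
    by (intro closure_of_subset openin_subset initial_data(1))
  obtain P :: "'m set" and N I where P: "finite P" and N: "\<And>m. m \<in> P \<Longrightarrow> compact (N m) \<and> N m \<subseteq> cdom A (I m)"
    and cover: "\<And>z. z \<in> ?T closure_of U \<Longrightarrow> \<exists>m\<in>P. fst z \<in> N m"
    using compact_cover_by_chart_compacts[OF atlas initial_data(2)] by metis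
  have "\<exists>C. \<exists>h0>0. \<forall>h x. 0 < h \<and> h \<le> h0 \<and> EL_solution A L h x \<and> tangent_lift A h x 0 \<in> U \<and> x 0 \<in> N m \<longrightarrow>
        err h x \<le> C * h ^ (?r + 1)" if "m \<in> P" for m
    using discrete_lagrangian_error_over_chart[OF atlas lipschitz second_order one_step_order(2) nodes(1,2) _ quadrature
        U initial_data(2) regularity shooting, of "N m" "I m"] N[OF that] nodes(3) by (simp add: err_def)
  then obtain C H where CH: "\<And>m. m \<in> P \<Longrightarrow> H m > 0 \<and> (\<forall>h x. 0 < h \<and> h \<le> H m \<and> EL_solution A L h x \<and>
        tangent_lift A h x 0 \<in> U \<and> x 0 \<in> N m \<longrightarrow> err h x \<le> C m * h ^ (?r + 1))"
    by metis
  \<comment> \<open>The extra element 1 keeps the minimum meaningful when \<open>P\<close> is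
    empty.\<close>
  define h0 where "h0 = Min (insert 1 (H ` P))"
  have "h0 > 0" unfolding h0_def using P CH by (subst Min_gr_iff) auto
  moreover have "err h x \<le> (\<Sum>m\<in>P. \<bar>C m\<bar>) * h ^ (?r + 1)"
    if h: "0 < h" "h \<le> h0" and x: "EL_solution A L h x" "tangent_lift A h x 0 \<in> U" for h x
  proof -
    obtain m where m: "m \<in> P" "x 0 \<in> N m"
      using cover[of "tangent_lift A h x 0"] U x(2) by (auto simp: tangent_lift_def)
    have "h0 \<le> H m" unfolding h0_def using P m by (intro Min_le) auto
    then have "err h x \<le> C m * h ^ (?r + 1)" using CH[OF m(1)] h x m by auto
    also have "C m \<le> (\<Sum>m\<in>P. \<bar>C m\<bar>)"
      using member_le_sum[OF m(1), of "\<lambda>m. \<bar>C m\<bar>"] P by simp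
    finally show ?thesis using h(1) by (simp add: mult_right_mono)
  qed
  ultimately show ?thesis
    unfolding discrete_lagrangian_order_def err_def by blast
qed

end
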